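(* Let $M$ be a loopless matroid with ground set $E$. Then \[ Z_M^{\mathrm{top}}(0) = 1, \] and \[ \left(\frac{d}{ds} Z^{\mathrm{top}}_M(s)\right) \Big|_{s = 0} = - \# E. \]
   Context: For a matroid $M$ on $E$ with rank function $\operatorname{rk}$, let $\operatorname{wt}_M(w)=\max_{B\text{ basis}}\sum_{e\in B}w_e$ for $w\in\mathbb{R}^E$, let $M_w$ be the matroid whose bases are the bases attaining this maximum, $|w|=\sum_e w_e$, and let $Z_M(q,T)=\sum_{w\in\mathbb{Z}_{\ge0}^E}\chi_{M_w}(q)q^{-\operatorname{rk}M-\operatorname{wt}_M(w)}T^{|w|}$ ($\chi$ the characteristic polynomial). Let $\mathbb{Z}[q^{\pm1}]\llbracket T\rrbracket_{\mathrm{rat}}$ be the $\mathbb{Z}[q^{\pm1}]$-subalgebra of $\mathbb{Z}[q^{\pm1}]\llbracket T\rrbracket$ generated by the elements $(q-1)q^bT^a/(1-q^bT^a)$, $a\in\mathbb{Z}_{>0},b\in\mathbb{Z}$; it contains $Z_M(q,T)$. Let $\mu_{\mathrm{top}}:\mathbb{Z}[q^{\pm1}]\llbracket T\rrbracket_{\mathrm{rat}}\to\mathbb{Q}(s)$ be the ring morphism with $\mu_{\mathrm{top}}(q)=1$ and $\mu_{\mathrm{top}}((q-1)q^bT^a/(1-q^bT^a))=1/(as-b)$. The topological zeta function is $Z_M^{\mathrm{top}}(s)=\mu_{\mathrm{top}}(Z_M(q,T))$. *)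

theory Defs
  imports
    "HOL-Computational_Algebra.Computational_Algebra"
    "HOL-Computational_Algebra.Field_as_Ring"
    "HOL-Library.Poly_Mapping"
    "HOL-Library.FuncSet"
begin

section \<open>Matroids\<close>

text \<open>A matroid on \<open>E\<close> is given by its ground set and its family of bases.\<close>

locale matroid =
  fixes E :: "'a set" and \<B> :: "'a set set"
  assumes finite_ground: "finite E"
    and bases_subset: "B \<in> \<B> \<Longrightarrow> B \<subseteq> E"
    and bases_nonempty: "\<B> \<noteq> {}"
    and basis_exchange:
      "\<lbrakk>B1 \<in> \<B>; B2 \<in> \<B>; x \<in> B1 - B2\<rbrakk> \<Longrightarrow> \<exists>y \<in> B2 - B1. insert y (B1 - {x}) \<in> \<B>"

definition indep :: "'a set set \<Rightarrow> 'a set \<Rightarrow> bool" where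
  "indep \<B> I \<longleftrightarrow> (\<exists>B\<in>\<B>. I \<subseteq> B)"

definition rk :: "'a set set \<Rightarrow> 'a set \<Rightarrow> nat" where
  "rk \<B> A = Max (card ` {I. I \<subseteq> A \<and> indep \<B> I})"

definition loopless :: "'a set \<Rightarrow> 'a set set \<Rightarrow> bool" where
  "loopless E \<B> \<longleftrightarrow> (\<forall>e\<in>E. indep \<B> {e})"

text \<open>The corank expansion of the characteristic polynomial. It is zero if the matroid has a loop;
  this matters because \<open>M\<^sub>w\<close> may have loops even if \<open>M\<close> has none.\<close>

definition char_poly :: "'a set \<Rightarrow> 'a set set \<Rightarrow> int poly" where
  "char_poly E \<B> = (\<Sum>A\<in>Pow E. monom ((- 1) ^ card A) (rk \<B> E - rk \<B> A))"

definition wt :: "'a set set \<Rightarrow> ('a \<Rightarrow> 'b::{linorder,comm_monoid_add}) \<Rightarrow> 'b" where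
  "wt \<B> w = Max ((\<lambda>B. \<Sum>e\<in>B. w e) ` \<B>)"

text \<open>The bases of \<open>M\<^sub>w\<close>.\<close>

definition max_bases :: "'a set set \<Rightarrow> ('a \<Rightarrow> 'b::{linorder,comm_monoid_add}) \<Rightarrow> 'a set set" where
  "max_bases \<B> w = {B \<in> \<B>. (\<Sum>e\<in>B. w e) = wt \<B> w}"

section \<open>The zeta function\<close>

text \<open>The Laurent polynomial ring \<open>\<int>[q\<^sup>\<plusminus>\<^sup>1]\<close> is the group ring of \<open>(\<int>, +)\<close>:
  finitely supported functions \<open>int \<Rightarrow> int\<close> with convolution as product.\<close>

type_synonym laurent = "int \<Rightarrow>\<^sub>0 int"

definition q_pow :: "int \<Rightarrow> laurent" where
  "q_pow b = Poly_Mapping.single b 1"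

lemma q_pow_0: "q_pow 0 = 1"
  by (simp add: q_pow_def)

lemma q_pow_add: "q_pow (a + b) = q_pow a * q_pow b"
  by (simp add: q_pow_def mult_single)

text \<open>The sum over all \<open>w \<in> \<int>\<^sub>\<ge>\<^sub>0\<^sup>E\<close> is grouped by \<open>|w|\<close>: only finitely many \<open>w\<close> contribute to a
  given power of \<open>T\<close>. Vectors indexed by \<open>E\<close> are functions that are \<open>undefined\<close> outside \<open>E\<close>.\<close>

definition zeta :: "'a set \<Rightarrow> 'a set set \<Rightarrow> laurent fps" where
  "zeta E \<B> = Abs_fps (\<lambda>n.
     \<Sum>w \<in> {w \<in> E \<rightarrow>\<^sub>E (UNIV :: nat set). (\<Sum>e\<in>E. w e) = n}.
       poly (map_poly of_int (char_poly E (max_bases \<B> w))) (q_pow 1) *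
       q_pow (- int (rk \<B> E) - int (wt \<B> w)))"

section \<open>The subalgebra and its specialization\<close>

text \<open>\<open>(q-1) q\<^sup>b T\<^sup>a / (1 - q\<^sup>b T\<^sup>a)\<close>. The library's \<open>inverse\<close> on power series needs a division ring of
  coefficients, hence the right inverse with constant coefficient 1.\<close>

definition rat_gen :: "nat \<Rightarrow> int \<Rightarrow> laurent fps" where
  "rat_gen a b = fps_const ((q_pow 1 - 1) * q_pow b) * fps_X ^ a *
     fps_right_inverse (1 - fps_const (q_pow b) * fps_X ^ a) 1"

lemma rat_gen_mult:
  assumes "a > 0"
  shows "rat_gen a b * (1 - fps_const (q_pow b) * fps_X ^ a) =
    fps_const ((q_pow 1 - 1) * q_pow b) * fps_X ^ a"
proof -
  let ?f = "1 - fps_const (q_pow b) * fps_X ^ a"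
  have "?f $ 0 * 1 = 1"
    using assms by simp
  then have "?f * fps_right_inverse ?f 1 = 1"
    by (rule fps_right_inverse)
  then show ?thesis
    by (simp add: rat_gen_def mult.assoc mult.commute[of _ ?f])
qed

inductive_set rat_fps :: "laurent fps set" where
  const: "fps_const c \<in> rat_fps"
| gen: "a > 0 \<Longrightarrow> rat_gen a b \<in> rat_fps"
| add: "\<lbrakk>f \<in> rat_fps; g \<in> rat_fps\<rbrakk> \<Longrightarrow> f + g \<in> rat_fps"
| mult: "\<lbrakk>f \<in> rat_fps; g \<in> rat_fps\<rbrakk> \<Longrightarrow> f * g \<in> rat_fps"

text \<open>\<open>\<rat>(s)\<close> is the field of fractions of the polynomial ring \<open>rat poly\<close>.\<close>

type_synonym ratfun = "rat poly fract"

definition ratfun_s :: ratfun where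
  "ratfun_s = Fract [:0, 1:] 1"

definition is_mu_top :: "(laurent fps \<Rightarrow> ratfun) \<Rightarrow> bool" where
  "is_mu_top \<mu> \<longleftrightarrow>
     \<mu> 1 = 1 \<and>
     (\<forall>f\<in>rat_fps. \<forall>g\<in>rat_fps. \<mu> (f + g) = \<mu> f + \<mu> g) \<and>
     (\<forall>f\<in>rat_fps. \<forall>g\<in>rat_fps. \<mu> (f * g) = \<mu> f * \<mu> g) \<and>
     \<mu> (fps_const (q_pow 1)) = 1 \<and>
     (\<forall>a>0. \<forall>b. \<mu> (rat_gen a b) = 1 / (of_nat a * ratfun_s - of_int b))"

text \<open>Membership in \<open>extensional rat_fps\<close> only fixes the irrelevant values outside the
  subalgebra, so that the morphism is unique as a total function.\<close>

definition mu_top :: "laurent fps \<Rightarrow> ratfun" where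
  "mu_top = (THE \<mu>. \<mu> \<in> extensional rat_fps \<and> is_mu_top \<mu>)"

definition zeta_top :: "'a set \<Rightarrow> 'a set set \<Rightarrow> ratfun" where
  "zeta_top E \<B> = mu_top (zeta E \<B>)"

section \<open>Evaluation and derivative of rational functions\<close>

text \<open>Evaluation uses the reduced fraction, so the value at \<open>x\<close> is the correct one whenever \<open>x\<close> is
  not a pole. At a pole the reduced denominator vanishes, and the value is 0 by the convention for
  division by 0; a nonzero value therefore certifies that \<open>x\<close> is not a pole.\<close>

definition ratfun_eval :: "ratfun \<Rightarrow> rat \<Rightarrow> rat" where
  "ratfun_eval r x = (case quot_of_fract r of (p, d) \<Rightarrow> poly p x / poly d x)"

definition ratfun_deriv :: "ratfun \<Rightarrow> ratfun" where
  "ratfun_deriv r =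
     (case quot_of_fract r of (p, d) \<Rightarrow> Fract (pderiv p * d - p * pderiv d) (d ^ 2))"

lemma ratfun_eval_Fract:
  assumes "poly d x \<noteq> 0"
  shows "ratfun_eval (Fract p d) x = poly p x / poly d x"
proof -
  from assms have "d \<noteq> 0" by auto
  then obtain c where c: "p = fst (normalize_quot (p, d)) * c"
      "d = snd (normalize_quot (p, d)) * c"
    by (rule normalize_quotE)
  have q: "quot_of_fract (Fract p d) = normalize_quot (p, d)"
    using quot_of_fract_quot_to_fract[of "(p, d)"] \<open>d \<noteq> 0\<close> by (simp add: quot_to_fract_def)
  obtain p' d' where pd: "normalize_quot (p, d) = (p', d')" by (cases "normalize_quot (p, d)")
  have e: "p = p' * c" "d = d' * c" using c unfolding pd by simp_all
  then have "poly c x \<noteq> 0" using assms by auto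
  then show ?thesis
    unfolding ratfun_eval_def q pd by (simp add: e)
qed

lemma ratfun_deriv_Fract:
  assumes "d \<noteq> 0"
  shows "ratfun_deriv (Fract p d) = Fract (pderiv p * d - p * pderiv d) (d ^ 2)"
proof -
  obtain c where c: "p = fst (normalize_quot (p, d)) * c"
      "d = snd (normalize_quot (p, d)) * c"
    using assms by (rule normalize_quotE)
  have q: "quot_of_fract (Fract p d) = normalize_quot (p, d)"
    using quot_of_fract_quot_to_fract[of "(p, d)"] assms by (simp add: quot_to_fract_def)
  obtain p' d' where pd: "normalize_quot (p, d) = (p', d')" by (cases "normalize_quot (p, d)")
  have e: "p = p' * c" "d = d' * c" using c unfolding pd by simp_all
  then have "c \<noteq> 0" "d' \<noteq> 0" using assms by auto
  then show ?thesis
    unfolding ratfun_deriv_def q pd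
    by (simp add: e eq_fract pderiv_mult power2_eq_square algebra_simps)
qed

end

theory Submission
  imports Defs
begin

text \<open>
  Sorting the weights \<open>w\<close> by their support \<open>F\<close> gives \<open>M\<^sub>w = (M|F)\<^sub>w \<oplus> M/F\<close>. Hence, with \<open>Y\<^sub>F\<close> the
  part of \<open>Z\<^bsub>M|F\<^esub>\<close> coming from weights without zero entry,
  \<open>Z\<^sub>M = \<Sum>\<^sub>F \<chi>\<^bsub>M/F\<^esub>(q) q\<^bsup>rk F - rk M\<^esup> Y\<^sub>F\<close>. For \<open>F \<noteq> E\<close> the polynomial \<open>\<chi>\<^bsub>M/F\<^esub>\<close> vanishes at \<open>1\<close>, so
  \<open>\<mu>\<^sub>t\<^sub>o\<^sub>p\<close> identifies \<open>Z\<^sub>M\<close> with \<open>Y\<^sub>E\<close> and yields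
  \<open>(#E s + rk M) Z\<^sub>M\<^sup>t\<^sup>o\<^sup>p(s) = \<Sum>\<^bsub>F \<noteq> E\<^esub> \<chi>'\<^bsub>M/F\<^esub>(1) Z\<^bsub>M|F\<^esub>\<^sup>t\<^sup>o\<^sup>p(s)\<close>.
  Induction on \<open>#E\<close> then reduces both claims to \<open>\<Sum>\<^sub>F \<chi>'\<^bsub>M/F\<^esub>(1) = rk M\<close> and
  \<open>\<Sum>\<^sub>F #F \<chi>'\<^bsub>M/F\<^esub>(1) = #E (rk M - 1)\<close>, which follow from the corank expansion.

  The morphism \<open>\<mu>\<^sub>t\<^sub>o\<^sub>p\<close> exists because substituting \<open>q = e\<^sup>h\<close>, \<open>T = e\<^sup>-\<^sup>s\<^sup>h\<close> sends the subalgebra into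
  \<open>\<rat>(s)[[h]]\<close>; it is the constant coefficient of the image.
\<close>

section \<open>The topological specialization\<close>

definition laurent_exp :: "laurent \<Rightarrow> ratfun fps" where
  "laurent_exp c = (\<Sum>k\<in>Poly_Mapping.keys c. of_int (Poly_Mapping.lookup c k) * fps_exp (of_int k))"

lemma laurent_exp_q_pow: "laurent_exp (q_pow k) = fps_exp (of_int k)"
  by (simp add: laurent_exp_def q_pow_def)

lemma laurent_exp_0 [simp]: "laurent_exp 0 = 0"
  by (simp add: laurent_exp_def)

lemma laurent_exp_1 [simp]: "laurent_exp 1 = 1"
  using laurent_exp_q_pow[of 0] by (simp add: q_pow_0)

lemma laurent_exp_add: "laurent_exp (c + d) = laurent_exp c + laurent_exp d"
  unfolding laurent_exp_def by (rule setsum_keys_plus_distrib) (simp_all add: algebra_simps)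

lemma laurent_exp_minus: "laurent_exp (- c) = - laurent_exp c"
  using laurent_exp_add[of c "- c"] by (simp add: add_eq_0_iff)

lemma laurent_exp_diff: "laurent_exp (c - d) = laurent_exp c - laurent_exp d"
  using laurent_exp_add[of c "- d"] by (simp add: laurent_exp_minus)

text \<open>Laurent polynomials are the free abelian group on the powers of \<open>q\<close>, so
  identities between additive maps need only be checked on those powers.\<close>

lemma laurent_induct [case_names zero q_pow diff]:
  assumes "P 0" "\<And>k. P (q_pow k)" "\<And>c d. P c \<Longrightarrow> P d \<Longrightarrow> P (c - d)"
  shows "P (c :: laurent)"
  using frag_induction[of c UNIV P] assms by (simp add: q_pow_def)

lemma laurent_exp_mult: "laurent_exp (c * d) = laurent_exp c * laurent_exp d"
proof (induction c rule: laurent_induct)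
  case (q_pow k)
  show ?case
  proof (induction d rule: laurent_induct)
    case (q_pow l)
    show ?case
      by (simp add: laurent_exp_q_pow fps_exp_add_mult flip: q_pow_add)
  qed (simp_all add: laurent_exp_diff algebra_simps)
qed (simp_all add: laurent_exp_diff algebra_simps)

text \<open>The arguments are polynomials in \<open>T\<close>; \<open>T\<close> becomes
  \<open>e^(-s h)\<close>, with \<open>h\<close> the variable of the target series.\<close>

definition poly_exp :: "laurent poly \<Rightarrow> ratfun fps" where
  "poly_exp P = poly (map_poly laurent_exp P) (fps_exp (- ratfun_s))"

lemma map_poly_hom_mult:
  fixes h :: "'a :: comm_ring_1 \<Rightarrow> 'b :: comm_ring_1"
  assumes "h 0 = 0" "\<And>a b. h (a + b) = h a + h b" "\<And>a b. h (a * b) = h a * h b"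
  shows "map_poly h (p * q) = map_poly h p * map_poly h q"
proof (rule poly_eqI)
  have sum: "h (sum f A) = (\<Sum>x\<in>A. h (f x))" for f and A :: "nat set"
    by (induction A rule: infinite_finite_induct) (simp_all add: assms)
  show "coeff (map_poly h (p * q)) n = coeff (map_poly h p * map_poly h q) n" for n
    by (simp add: coeff_map_poly coeff_mult assms sum)
qed

lemma poly_exp_mult: "poly_exp (P * Q) = poly_exp P * poly_exp Q"
  unfolding poly_exp_def
  by (subst map_poly_hom_mult) (simp_all add: laurent_exp_add laurent_exp_mult)

lemma poly_exp_add: "poly_exp (P + Q) = poly_exp P + poly_exp Q"
proof -
  have "map_poly laurent_exp (P + Q) = map_poly laurent_exp P + map_poly laurent_exp Q"
    by (rule poly_eqI) (simp add: coeff_map_poly laurent_exp_add)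
  then show ?thesis
    by (simp add: poly_exp_def)
qed

lemma poly_exp_const: "poly_exp [:c:] = laurent_exp c"
  by (simp add: poly_exp_def map_poly_pCons)

lemma poly_exp_1 [simp]: "poly_exp 1 = 1"
  using poly_exp_const[of 1] by (simp add: one_pCons)

lemma poly_exp_monom: "poly_exp (monom c n) = laurent_exp c * fps_exp (- of_nat n * ratfun_s)"
  by (simp add: poly_exp_def map_poly_monom poly_monom fps_exp_power_mult)

text \<open>Infinitely many powers of \<open>T = e\<^sup>-\<^sup>s\<^sup>h\<close> cannot be summed, so the expansion of a power series
  is defined through its representations as a quotient of polynomials in \<open>T\<close>.\<close>

definition expands_to :: "laurent fps \<Rightarrow> ratfun fps \<Rightarrow> bool" where
  "expands_to f g \<longleftrightarrow> (\<exists>N D. f * fps_of_poly D = fps_of_poly N \<and>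
     poly_exp D \<noteq> 0 \<and> poly_exp N = g * poly_exp D)"

text \<open>Cross-multiplying two representations gives an identity of polynomials in
  \<open>T\<close>. The substitution preserves it, and the nonzero denominators cancel in the
  integral domain of target series.\<close>

lemma expands_to_unique:
  assumes "expands_to f g" "expands_to f h"
  shows "g = h"
proof -
  obtain N D where 1: "f * fps_of_poly D = fps_of_poly N"
    "poly_exp D \<noteq> 0" "poly_exp N = g * poly_exp D"
    using assms(1) by (auto simp: expands_to_def)
  obtain N' D' where 2: "f * fps_of_poly D' = fps_of_poly N'"
    "poly_exp D' \<noteq> 0" "poly_exp N' = h * poly_exp D'"
    using assms(2) by (auto simp: expands_to_def)
  have "fps_of_poly (N * D') = fps_of_poly (N' * D)"
    unfolding fps_of_poly_mult 1(1)[symmetric] 2(1)[symmetric] by (simp add: ac_simps)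
  then have "poly_exp (N * D') = poly_exp (N' * D)"
    by (simp add: fps_of_poly_eq_iff)
  then have "(g - h) * (poly_exp D * poly_exp D') = 0"
    by (simp add: poly_exp_mult 1(3) 2(3) algebra_simps)
  with 1(2) 2(2) show ?thesis
    by simp
qed

lemma expands_to_const: "expands_to (fps_const c) (laurent_exp c)"
  unfolding expands_to_def
  by (intro exI[of _ "[:c:]"] exI[of _ 1]) (simp add: fps_of_poly_const poly_exp_const)

lemma expands_to_add:
  assumes "expands_to f g" "expands_to f' g'"
  shows "expands_to (f + f') (g + g')"
proof -
  obtain N D where 1: "f * fps_of_poly D = fps_of_poly N"
    "poly_exp D \<noteq> 0" "poly_exp N = g * poly_exp D"
    using assms(1) by (auto simp: expands_to_def)
  obtain N' D' where 2: "f' * fps_of_poly D' = fps_of_poly N'"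
    "poly_exp D' \<noteq> 0" "poly_exp N' = g' * poly_exp D'"
    using assms(2) by (auto simp: expands_to_def)
  have "(f + f') * fps_of_poly (D * D') = fps_of_poly (N * D' + N' * D)"
    unfolding fps_of_poly_mult fps_of_poly_add 1(1)[symmetric] 2(1)[symmetric]
    by (simp add: algebra_simps)
  moreover have "poly_exp (N * D' + N' * D) = (g + g') * poly_exp (D * D')"
    by (simp add: poly_exp_mult poly_exp_add 1(3) 2(3) algebra_simps)
  ultimately show ?thesis
    unfolding expands_to_def using 1(2) 2(2) by (metis poly_exp_mult mult_eq_0_iff)
qed

lemma expands_to_mult:
  assumes "expands_to f g" "expands_to f' g'"
  shows "expands_to (f * f') (g * g')"
proof -
  obtain N D where 1: "f * fps_of_poly D = fps_of_poly N"
    "poly_exp D \<noteq> 0" "poly_exp N = g * poly_exp D"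
    using assms(1) by (auto simp: expands_to_def)
  obtain N' D' where 2: "f' * fps_of_poly D' = fps_of_poly N'"
    "poly_exp D' \<noteq> 0" "poly_exp N' = g' * poly_exp D'"
    using assms(2) by (auto simp: expands_to_def)
  have "f * f' * fps_of_poly (D * D') = fps_of_poly (N * N')"
    unfolding fps_of_poly_mult 1(1)[symmetric] 2(1)[symmetric] by (simp add: algebra_simps)
  moreover have "poly_exp (N * N') = g * g' * poly_exp (D * D')"
    by (simp add: poly_exp_mult 1(3) 2(3) algebra_simps)
  ultimately show ?thesis
    unfolding expands_to_def using 1(2) 2(2) by (metis poly_exp_mult mult_eq_0_iff)
qed

lemma ratfun_linear: "of_nat a * ratfun_s - of_int b = Fract [:- of_int b, of_nat a:] 1"
proof -
  have n: "(of_nat k :: ratfun) = Fract [:of_nat k:] 1" for k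
    by (simp add: of_nat_fract of_nat_poly)
  have "(of_int b :: ratfun) = Fract [:of_int b:] 1"
    by (cases b rule: int_cases2) (simp_all add: n)
  then show ?thesis
    by (simp add: n ratfun_s_def)
qed

lemma ratfun_linear_nonzero:
  assumes "a > 0"
  shows "of_nat a * ratfun_s - of_int b \<noteq> 0"
  using assms by (simp add: ratfun_linear Zero_fract_def eq_fract)

text \<open>With \<open>u = b - a s\<close> the generator becomes
  \<open>(e^h - 1) e^(u h) / (1 - e^(u h))\<close>. Numerator and denominator have simple zeros at
  \<open>h = 0\<close> with slopes \<open>1\<close> and \<open>-u\<close>, so the constant term is
  \<open>-1 / u\<close>.\<close>

lemma expands_to_rat_gen:
  assumes "a > 0"
  obtains g where "expands_to (rat_gen a b) g" "g $ 0 = 1 / (of_nat a * ratfun_s - of_int b)"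
proof
  define u :: ratfun where "u = of_int b - of_nat a * ratfun_s"
  have u: "u \<noteq> 0"
    using ratfun_linear_nonzero[OF assms, of b] by (auto simp: u_def)
  \<comment> \<open>One factor \<open>h\<close> is removed from the denominator and from
    \<open>e^h - 1\<close>; the constant term \<open>-u\<close> then makes \<open>V\<close>
    invertible.\<close>
  define V where "V = fps_shift 1 (1 - fps_exp u)"
  define W where "W = fps_shift 1 (fps_exp 1 - 1 :: ratfun fps)"
  have V: "1 - fps_exp u = V * fps_X" and W: "fps_exp 1 - 1 = W * fps_X"
    by (simp_all add: fps_eq_iff V_def W_def)
  have V0: "V $ 0 = - u" and W0: "W $ 0 = 1"
    by (simp_all add: V_def W_def)
  define g where "g = W * fps_exp u * inverse V"
  have gV: "g * V = W * fps_exp u"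
    using u V0 by (simp add: g_def mult.assoc inverse_mult_eq_1)
  have e: "fps_exp (of_int b) * fps_exp (- (of_nat a * ratfun_s)) = fps_exp u"
    by (simp add: u_def flip: fps_exp_add_mult)
  have D: "poly_exp (1 - monom (q_pow b) a) = 1 - fps_exp u"
    using poly_exp_add[of "1 - monom (q_pow b) a" "monom (q_pow b) a"]
    by (simp add: poly_exp_monom laurent_exp_q_pow e eq_diff_eq)
  have N: "poly_exp (monom ((q_pow 1 - 1) * q_pow b) a) = (fps_exp 1 - 1) * fps_exp u"
    by (simp add: poly_exp_monom laurent_exp_q_pow laurent_exp_mult laurent_exp_diff mult.assoc e)
  have "g * (1 - fps_exp u) = (fps_exp 1 - 1) * fps_exp u"
    unfolding V W using gV by (simp add: ac_simps)
  moreover have "1 - fps_exp u \<noteq> 0"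
    using u by simp
  moreover have "rat_gen a b * fps_of_poly (1 - monom (q_pow b) a) =
      fps_of_poly (monom ((q_pow 1 - 1) * q_pow b) a)"
    using rat_gen_mult[OF assms, of b] by (simp add: fps_of_poly_diff fps_of_poly_monom)
  ultimately show "expands_to (rat_gen a b) g"
    unfolding expands_to_def using D N by metis
  show "g $ 0 = 1 / (of_nat a * ratfun_s - of_int b)"
    using u V0 W0 by (simp add: g_def u_def field_simps)
qed

lemma rat_fps_expands:
  assumes "f \<in> rat_fps"
  shows "\<exists>!g. expands_to f g"
proof -
  from assms have "\<exists>g. expands_to f g"
    by induction (blast intro: expands_to_const expands_to_add expands_to_mult
        elim: expands_to_rat_gen)+
  then show ?thesis
    using expands_to_unique by blast
qed

text \<open>Uniqueness of expansions turns closure under sums and products into additivity and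
  multiplicativity. Taking the constant coefficient is a ring morphism and sends \<open>e^h\<close>
  to 1.\<close>

lemma is_mu_top_expansion: "is_mu_top (\<lambda>f. (THE g. expands_to f g) $ 0)"
proof -
  have the: "(THE g. expands_to f g) = g" if "expands_to f g" for f g
    using that expands_to_unique by blast
  have ex: "expands_to f (THE g. expands_to f g)" if "f \<in> rat_fps" for f
    using rat_fps_expands[OF that] by (rule theI')
  have one: "expands_to 1 1"
    using expands_to_const[of 1] by simp
  have gen: "(THE g. expands_to (rat_gen a b) g) $ 0 = 1 / (of_nat a * ratfun_s - of_int b)"
    if "a > 0" for a b
    using expands_to_rat_gen[OF that, of b] the by metis
  show ?thesis
    unfolding is_mu_top_def
    using the[OF one] the[OF expands_to_const[of "q_pow 1"]] gen
      the[OF expands_to_add[OF ex ex]] the[OF expands_to_mult[OF ex ex]]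
    by (simp add: laurent_exp_q_pow)
qed

text \<open>An arbitrary map with the defining properties: uniqueness compares two of them, and the
  final computation takes \<open>mu_top\<close>.\<close>

locale top_specialization =
  fixes \<mu> :: "laurent fps \<Rightarrow> ratfun"
  assumes mu: "is_mu_top \<mu>"
begin

lemma mu_add: "f \<in> rat_fps \<Longrightarrow> g \<in> rat_fps \<Longrightarrow> \<mu> (f + g) = \<mu> f + \<mu> g"
  and mu_mult: "f \<in> rat_fps \<Longrightarrow> g \<in> rat_fps \<Longrightarrow> \<mu> (f * g) = \<mu> f * \<mu> g"
  and mu_1: "\<mu> 1 = 1"
  and mu_q: "\<mu> (fps_const (q_pow 1)) = 1"
  and mu_rat_gen: "a > 0 \<Longrightarrow> \<mu> (rat_gen a b) = 1 / (of_nat a * ratfun_s - of_int b)"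
  using mu by (auto simp: is_mu_top_def)

lemma mu_const_add: "\<mu> (fps_const (c + d)) = \<mu> (fps_const c) + \<mu> (fps_const d)"
  using mu_add[of "fps_const c" "fps_const d"] by (simp add: rat_fps.const)

lemma mu_const_mult: "\<mu> (fps_const (c * d)) = \<mu> (fps_const c) * \<mu> (fps_const d)"
  using mu_mult[of "fps_const c" "fps_const d"] by (simp add: rat_fps.const)

lemma mu_0: "\<mu> 0 = 0"
  using mu_const_add[of 0 0] by simp

lemma mu_const_diff: "\<mu> (fps_const (c - d)) = \<mu> (fps_const c) - \<mu> (fps_const d)"
  using mu_const_add[of "c - d" d] by (simp add: algebra_simps)

lemma mu_q_pow: "\<mu> (fps_const (q_pow k)) = 1"
proof (induction k rule: int_induct[where k = 0])
  case (step1 i)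
  then show ?case
    by (simp add: q_pow_add mu_const_mult mu_q)
next
  case (step2 i)
  have "q_pow i = q_pow (i - 1) * q_pow 1"
    by (simp flip: q_pow_add)
  with step2 show ?case
    by (simp add: mu_const_mult mu_q)
qed (simp add: q_pow_0 mu_1)

lemma mu_const_int: "\<mu> (fps_const (of_int m)) = of_int m"
proof (induction m rule: int_induct[where k = 0])
qed (simp_all add: mu_0 mu_const_add mu_const_diff mu_1)

lemma mu_const_poly:
  "\<mu> (fps_const (poly (map_poly of_int p) (q_pow 1))) = of_int (poly p 1)"
proof (induction p)
  case (pCons a p)
  then show ?case
    by (simp add: map_poly_pCons mu_const_add mu_const_mult mu_const_int mu_q)
qed (simp add: mu_0)

end

text \<open>Constants are integer combinations of powers of \<open>q\<close>, which all go to 1;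
  generators have prescribed values, and sums and products reach the whole subalgebra.\<close>

lemma is_mu_top_unique:
  assumes "is_mu_top \<mu>" "is_mu_top \<nu>" "f \<in> rat_fps"
  shows "\<mu> f = \<nu> f"
proof -
  interpret \<mu>: top_specialization \<mu> by standard fact
  interpret \<nu>: top_specialization \<nu> by standard fact
  have const: "\<mu> (fps_const c) = \<nu> (fps_const c)" for c
    by (induction c rule: laurent_induct)
      (simp_all add: \<mu>.mu_0 \<nu>.mu_0 \<mu>.mu_q_pow \<nu>.mu_q_pow \<mu>.mu_const_diff \<nu>.mu_const_diff)
  from assms(3) show ?thesis
    by induction (simp_all add: const \<mu>.mu_rat_gen \<nu>.mu_rat_gen
        \<mu>.mu_add \<nu>.mu_add \<mu>.mu_mult \<nu>.mu_mult)
qed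

lemma is_mu_top_restrict: "is_mu_top \<mu> \<Longrightarrow> is_mu_top (restrict \<mu> rat_fps)"
  using rat_fps.const[of 1] rat_fps.const[of "q_pow 1"]
  by (auto simp: is_mu_top_def intro: rat_fps.intros)

text \<open>Existence from the expansion and uniqueness on the subalgebra justify the definite
  description; restricting settles the values elsewhere.\<close>

interpretation mu_top: top_specialization mu_top
proof
  let ?\<mu> = "restrict (\<lambda>f. (THE g. expands_to f g) $ 0) rat_fps"
  have "?\<mu> \<in> extensional rat_fps \<and> is_mu_top ?\<mu>"
    by (simp add: is_mu_top_restrict is_mu_top_expansion)
  moreover have "\<mu> = ?\<mu>" if "\<mu> \<in> extensional rat_fps \<and> is_mu_top \<mu>" for \<mu>
    using that is_mu_top_unique[OF _ is_mu_top_restrict[OF is_mu_top_expansion]]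
    by (intro extensionalityI[of _ rat_fps]) auto
  ultimately show "is_mu_top mu_top"
    unfolding mu_top_def by (rule theI2) auto
qed

section \<open>Matroids\<close>

text \<open>An independent subset of \<open>A\<close> lies in the trace of a basis on
  \<open>A\<close>, and every trace is independent. The generality allows \<open>max_bases\<close>
  to be treated as a mere family of sets.\<close>

lemma rk_eq_Max:
  assumes "finite \<B>" "\<B> \<noteq> {}" "\<And>B. B \<in> \<B> \<Longrightarrow> finite B"
  shows "rk \<B> A = Max ((\<lambda>B. card (B \<inter> A)) ` \<B>)"
proof -
  have "{I. I \<subseteq> A \<and> indep \<B> I} \<subseteq> Pow (\<Union>\<B>)"
    by (auto simp: indep_def)
  then have fin: "finite {I. I \<subseteq> A \<and> indep \<B> I}"
    by (rule finite_subset) (use assms in auto)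
  show ?thesis
    unfolding rk_def
  proof (rule Max_eq_if)
    show "finite (card ` {I. I \<subseteq> A \<and> indep \<B> I})"
      using fin by simp
    show "finite ((\<lambda>B. card (B \<inter> A)) ` \<B>)"
      using assms by simp
    show "\<forall>a\<in>card ` {I. I \<subseteq> A \<and> indep \<B> I}. \<exists>b\<in>(\<lambda>B. card (B \<inter> A)) ` \<B>. a \<le> b"
    proof
      fix a assume "a \<in> card ` {I. I \<subseteq> A \<and> indep \<B> I}"
      then obtain I B where "a = card I" "I \<subseteq> A" "B \<in> \<B>" "I \<subseteq> B"
        by (auto simp: indep_def)
      then show "\<exists>b\<in>(\<lambda>B. card (B \<inter> A)) ` \<B>. a \<le> b"
        using assms(3) by (auto intro!: bexI[of _ B] card_mono)
    qed
    show "\<forall>b\<in>(\<lambda>B. card (B \<inter> A)) ` \<B>. \<exists>a\<in>card ` {I. I \<subseteq> A \<and> indep \<B> I}. b \<le> a"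
      by (auto simp: indep_def intro!: exI[of _ "_ \<inter> A"])
  qed
qed

lemma card_Int_le_rk:
  assumes "finite \<B>" "\<And>B. B \<in> \<B> \<Longrightarrow> finite B" "B \<in> \<B>"
  shows "card (B \<inter> A) \<le> rk \<B> A"
proof -
  have "rk \<B> A = Max ((\<lambda>B. card (B \<inter> A)) ` \<B>)"
    using assms by (intro rk_eq_Max) auto
  then show ?thesis
    using assms by simp
qed

lemma rk_attained:
  assumes "finite \<B>" "\<B> \<noteq> {}" "\<And>B. B \<in> \<B> \<Longrightarrow> finite B"
  obtains B where "B \<in> \<B>" "card (B \<inter> A) = rk \<B> A"
proof -
  have "Max ((\<lambda>B. card (B \<inter> A)) ` \<B>) \<in> (\<lambda>B. card (B \<inter> A)) ` \<B>"
    using assms by (intro Max_in) auto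
  then show thesis
    using that rk_eq_Max[OF assms, of A] by auto
qed

lemma rk_mono:
  assumes "finite \<B>" "\<B> \<noteq> {}" "\<And>B. B \<in> \<B> \<Longrightarrow> finite B" "A \<subseteq> A'"
  shows "rk \<B> A \<le> rk \<B> A'"
proof -
  obtain B where B: "B \<in> \<B>" "card (B \<inter> A) = rk \<B> A"
    using rk_attained assms(1-3) by metis
  have "card (B \<inter> A) \<le> card (B \<inter> A')"
    using assms B by (intro card_mono) auto
  also have "\<dots> \<le> rk \<B> A'"
    using assms B by (intro card_Int_le_rk) auto
  finally show ?thesis
    using B by simp
qed

lemma wt_ge: "finite \<B> \<Longrightarrow> B \<in> \<B> \<Longrightarrow> (\<Sum>e\<in>B. w e) \<le> wt \<B> w"
  by (simp add: wt_def)

lemma max_bases_nonempty: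
  assumes "finite \<B>" "\<B> \<noteq> {}"
  shows "max_bases \<B> w \<noteq> {}"
proof -
  have "wt \<B> w \<in> (\<lambda>B. \<Sum>e\<in>B. w e) ` \<B>"
    unfolding wt_def using assms by (intro Max_in) auto
  then show ?thesis
    by (auto simp: max_bases_def)
qed

text \<open>Meant for the bases of \<open>M|F\<close>, which all have \<open>rk F\<close> elements:
  raising every entry on \<open>F\<close> by one shifts all their weights equally.\<close>

lemma wt_shift:
  fixes w :: "'a \<Rightarrow> nat"
  assumes "finite \<B>" "\<B> \<noteq> {}" "\<And>B. B \<in> \<B> \<Longrightarrow> (\<Sum>e\<in>B. w e) = (\<Sum>e\<in>B. w' e) + c"
  shows "wt \<B> w = wt \<B> w' + c" and "max_bases \<B> w = max_bases \<B> w'"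
proof -
  have "(\<lambda>B. \<Sum>e\<in>B. w e) ` \<B> = (\<lambda>B. (\<Sum>e\<in>B. w' e) + c) ` \<B>"
    using assms(3) by (intro image_cong) auto
  then show "wt \<B> w = wt \<B> w' + c"
    unfolding wt_def using Max_add_commute[OF assms(1,2)] by simp
  then show "max_bases \<B> w = max_bases \<B> w'"
    unfolding max_bases_def using assms(3) by auto
qed

section \<open>Restriction and augmentation\<close>

definition restriction :: "'a set set \<Rightarrow> 'a set \<Rightarrow> 'a set set" where
  "restriction \<B> F = (\<lambda>B. B \<inter> F) ` {B \<in> \<B>. card (B \<inter> F) = rk \<B> F}"

context matroid
begin

lemma finite_basis: "B \<in> \<B> \<Longrightarrow> finite B"
  using bases_subset finite_ground finite_subset by blast

lemma finite_bases: "finite \<B>"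
  using bases_subset finite_ground by (auto intro: finite_subset[of _ "Pow E"])

lemmas bases_family = finite_bases bases_nonempty finite_basis

lemma finite_indep: "indep \<B> I \<Longrightarrow> finite I"
  using finite_basis by (auto simp: indep_def intro: finite_subset)

lemma indep_mono: "indep \<B> I \<Longrightarrow> J \<subseteq> I \<Longrightarrow> indep \<B> J"
  by (auto simp: indep_def)

text \<open>Each exchange keeps the size of \<open>B1\<close> and brings it closer to
  \<open>B2\<close>, until it is contained in \<open>B2\<close>.\<close>

lemma card_basis_le:
  assumes "B1 \<in> \<B>" "B2 \<in> \<B>"
  shows "card B1 \<le> card B2"
  using assms
proof (induction "card (B1 - B2)" arbitrary: B1 rule: less_induct)
  case less
  show ?case
  proof (cases "B1 \<subseteq> B2")
    case True
    then show ?thesis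
      using less.prems finite_basis by (intro card_mono) auto
  next
    case False
    then obtain x where x: "x \<in> B1 - B2"
      by blast
    then obtain y where y: "y \<in> B2 - B1" "insert y (B1 - {x}) \<in> \<B>"
      using basis_exchange less.prems by blast
    have "card (insert y (B1 - {x}) - B2) < card (B1 - B2)"
      using x y finite_basis[OF less.prems(1)] by (intro psubset_card_mono) auto
    then have "card (insert y (B1 - {x})) \<le> card B2"
      using less.hyps y less.prems by blast
    moreover have "card (insert y (B1 - {x})) = card B1"
      using x y finite_basis[OF less.prems(1)] card.remove[of B1 x]
      by (simp del: card_Diff_singleton)
    ultimately show ?thesis
      by simp
  qed
qed

lemma card_basis: "B1 \<in> \<B> \<Longrightarrow> B2 \<in> \<B> \<Longrightarrow> card B1 = card B2"
  by (simp add: card_basis_le le_antisym)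

text \<open>In a basis through \<open>J\<close>, elements outside \<open>J\<close> and
  \<open>B1\<close> are exchanged one by one for elements of \<open>B1\<close>; \<open>J\<close> is
  never touched.\<close>

lemma basis_extension:
  assumes "indep \<B> J" "B1 \<in> \<B>"
  obtains B where "B \<in> \<B>" "J \<subseteq> B" "B \<subseteq> J \<union> B1"
proof -
  have "\<exists>B\<in>\<B>. J \<subseteq> B \<and> B \<subseteq> J \<union> B1" if "B2 \<in> \<B>" "J \<subseteq> B2" for B2
    using that
  proof (induction "card (B2 - (J \<union> B1))" arbitrary: B2 rule: less_induct)
    case less
    show ?case
    proof (cases "B2 \<subseteq> J \<union> B1")
      case False
      then obtain x where x: "x \<in> B2" "x \<notin> J" "x \<notin> B1"
        by blast
      then obtain y where y: "y \<in> B1 - B2" "insert y (B2 - {x}) \<in> \<B>"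
        using basis_exchange less.prems(1) assms(2) by blast
      have "card (insert y (B2 - {x}) - (J \<union> B1)) < card (B2 - (J \<union> B1))"
        using x y finite_basis[OF less.prems(1)] by (intro psubset_card_mono) auto
      then show ?thesis
        using less.hyps x y less.prems by blast
    qed (use less.prems in blast)
  qed
  then show thesis
    using assms that by (auto simp: indep_def)
qed

text \<open>If no element of \<open>J\<close> augments \<open>I\<close>, take bases
  \<open>B1\<close> over \<open>I\<close> and \<open>B2\<close> over \<open>J\<close> with
  \<open>B2\<close> inside the union of \<open>J\<close> and \<open>B1\<close>. Then
  \<open>|J - I| <= |B2 - B1| = |B1 - B2| <= |I - J|\<close>, so \<open>J\<close> is not larger than
  \<open>I\<close>.\<close>

lemma indep_augment:
  assumes "indep \<B> I" "indep \<B> J" "card I < card J"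
  shows "\<exists>e\<in>J - I. indep \<B> (insert e I)"
proof (rule ccontr)
  assume "\<not> (\<exists>e\<in>J - I. indep \<B> (insert e I))"
  then have max: "\<not> indep \<B> (insert e I)" if "e \<in> J - I" for e
    using that by blast
  obtain B1 where B1: "B1 \<in> \<B>" "I \<subseteq> B1"
    using assms(1) by (auto simp: indep_def)
  obtain B2 where B2: "B2 \<in> \<B>" "J \<subseteq> B2" "B2 \<subseteq> J \<union> B1"
    using basis_extension[OF assms(2) B1(1)] .
  have JB1: "J \<inter> B1 \<subseteq> I"
    using max B1 by (auto simp: indep_def)
  \<comment> \<open>Exchanging an \<open>x\<close> outside \<open>I\<close> would bring in some
    \<open>y\<close> of \<open>J - I\<close> while keeping \<open>I\<close>, so \<open>y\<close>
    would augment \<open>I\<close>.\<close>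
  have "B1 - B2 \<subseteq> I"
  proof
    fix x assume x: "x \<in> B1 - B2"
    then obtain y where y: "y \<in> B2 - B1" "insert y (B1 - {x}) \<in> \<B>"
      using basis_exchange B1 B2 by blast
    show "x \<in> I"
    proof (rule ccontr)
      assume "x \<notin> I"
      then have "indep \<B> (insert y I)"
        unfolding indep_def using y(2) B1(2)
        by (intro bexI[of _ "insert y (B1 - {x})"]) auto
      then have "y \<notin> J - I"
        using max by metis
      then show False
        using y(1) B1(2) B2(3) by blast
    qed
  qed
  then have "card (B1 - B2) \<le> card (I - J)"
    using B2 finite_indep[OF assms(1)] by (intro card_mono) auto
  moreover have "card (J - I) \<le> card (B2 - B1)"
    using B2 JB1 finite_basis by (intro card_mono) auto
  moreover have "card (B1 - B2) = card (B2 - B1)"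
    using card_basis[OF B1(1) B2(1)] finite_basis B1 B2
    by (simp add: card_Diff_subset_Int Int_commute)
  ultimately have "card (J - I) \<le> card (I - J)"
    by simp
  moreover have "card J = card (J - I) + card (I \<inter> J)" "card I = card (I - J) + card (I \<inter> J)"
    using finite_indep[OF assms(1)] finite_indep[OF assms(2)]
    by (metis Diff_Int_distrib2 Int_commute add.commute card_Int_Diff)+
  ultimately show False
    using assms(3) by simp
qed

lemma card_indep_le_rk:
  assumes "indep \<B> I" "I \<subseteq> A"
  shows "card I \<le> rk \<B> A"
proof -
  obtain B where B: "B \<in> \<B>" "I \<subseteq> B"
    using assms by (auto simp: indep_def)
  have "card I \<le> card (B \<inter> A)"
    using B assms finite_basis by (intro card_mono) auto
  also have "\<dots> \<le> rk \<B> A"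
    using card_Int_le_rk finite_bases finite_basis B(1) by blast
  finally show ?thesis .
qed

text \<open>The trace on \<open>A\<close> of a basis meeting \<open>A\<close> maximally supplies
  augmenting elements until the rank of \<open>A\<close> is reached.\<close>

lemma indep_extend_within:
  assumes "indep \<B> I" "I \<subseteq> A"
  obtains J where "indep \<B> J" "I \<subseteq> J" "J \<subseteq> A" "card J = rk \<B> A"
proof -
  obtain B where B: "B \<in> \<B>" "card (B \<inter> A) = rk \<B> A"
    using rk_attained bases_family by metis
  have BA: "indep \<B> (B \<inter> A)"
    using B by (auto simp: indep_def)
  have "\<exists>J. indep \<B> J \<and> I \<subseteq> J \<and> J \<subseteq> A \<and> card J = rk \<B> A"
    using assms
  proof (induction "rk \<B> A - card I" arbitrary: I rule: less_induct)
    case less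
    show ?case
    proof (cases "card I < rk \<B> A")
      case True
      then obtain e where e: "e \<in> B \<inter> A - I" "indep \<B> (insert e I)"
        using indep_augment[OF less.prems(1) BA] B(2) by metis
      have "rk \<B> A - card (insert e I) < rk \<B> A - card I"
        using True e finite_indep[OF less.prems(1)] by simp
      then show ?thesis
        using less.hyps[of "insert e I"] e less.prems by blast
    next
      case False
      then show ?thesis
        using less.prems card_indep_le_rk[OF less.prems] by auto
    qed
  qed
  then show thesis
    using that by blast
qed

text \<open>A basis containing such a \<open>J\<close> meets \<open>F\<close> in at most
  \<open>rk F\<close> elements, so its trace on \<open>F\<close> is exactly
  \<open>J\<close>.\<close>

lemma restriction_iff:
  "J \<in> restriction \<B> F \<longleftrightarrow> indep \<B> J \<and> J \<subseteq> F \<and> card J = rk \<B> F"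
proof
  assume "indep \<B> J \<and> J \<subseteq> F \<and> card J = rk \<B> F"
  then obtain B where B: "B \<in> \<B>" "J \<subseteq> B" and J: "J \<subseteq> F" "card J = rk \<B> F"
    by (auto simp: indep_def)
  have "card (B \<inter> F) \<le> card J"
    using J card_Int_le_rk finite_bases finite_basis B(1) by metis
  then have "J = B \<inter> F"
    using B J finite_basis by (intro card_seteq) auto
  then show "J \<in> restriction \<B> F"
    using B J by (auto simp: restriction_def)
qed (auto simp: restriction_def indep_def)

text \<open>Exchange is augmentation of \<open>B1 - {x}\<close> from the larger independent set
  \<open>B2\<close>.\<close>

lemma matroid_restriction:
  assumes "F \<subseteq> E"
  shows "matroid F (restriction \<B> F)"
proof
  show "finite F"
    using assms finite_ground finite_subset by blast
  show "B \<subseteq> F" if "B \<in> restriction \<B> F" for B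
    using that by (simp add: restriction_iff)
  have "indep \<B> {}"
    using bases_nonempty by (auto simp: indep_def)
  then obtain J where "J \<in> restriction \<B> F"
    by (rule indep_extend_within[of "{}" F]) (simp_all add: restriction_iff)
  then show "restriction \<B> F \<noteq> {}"
    by blast
  fix B1 B2 x
  assume B: "B1 \<in> restriction \<B> F" "B2 \<in> restriction \<B> F" and x: "x \<in> B1 - B2"
  have fin: "finite B1"
    using B finite_indep by (auto simp: restriction_iff)
  have "indep \<B> (B1 - {x})" "indep \<B> B2" "card (B1 - {x}) < card B2"
    using B x fin indep_mono[of B1 "B1 - {x}"] card_Diff1_less[OF fin, of x]
    by (auto simp: restriction_iff)
  then obtain y where y: "y \<in> B2 - (B1 - {x})" "indep \<B> (insert y (B1 - {x}))"
    using indep_augment by blast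
  then have "card (insert y (B1 - {x})) = card B1"
    using x fin card.remove[of B1 x] by (simp del: card_Diff_singleton)
  then show "\<exists>y\<in>B2 - B1. insert y (B1 - {x}) \<in> restriction \<B> F"
    using B x y by (intro bexI[of _ y]) (auto simp: restriction_iff)
qed

lemma rk_ground: "B \<in> \<B> \<Longrightarrow> rk \<B> E = card B"
  by (metis bases_subset card_basis inf.absorb1 rk_attained bases_family)

lemma restriction_ground: "restriction \<B> E = \<B>"
  using rk_ground bases_subset by (force simp: restriction_def inf.absorb1)

lemma rk_restriction:
  assumes "F \<subseteq> E"
  shows "rk (restriction \<B> F) F = rk \<B> F"
proof -
  interpret R: matroid F "restriction \<B> F"
    using assms by (rule matroid_restriction)
  obtain B where "B \<in> restriction \<B> F"
    using R.bases_nonempty by blast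
  then show ?thesis
    using R.rk_ground by (auto simp: restriction_iff)
qed

lemma loopless_restriction:
  assumes "loopless E \<B>" "F \<subseteq> E"
  shows "loopless F (restriction \<B> F)"
  unfolding loopless_def
proof
  fix e assume "e \<in> F"
  then obtain J where "indep \<B> J" "{e} \<subseteq> J" "J \<subseteq> F" "card J = rk \<B> F"
    using assms indep_extend_within[of "{e}" F] by (auto simp: loopless_def)
  then have "J \<in> restriction \<B> F" "{e} \<subseteq> J"
    by (auto simp: restriction_iff)
  then show "indep (restriction \<B> F) {e}"
    unfolding indep_def by blast
qed

section \<open>The matroid \<open>M_w\<close> for weights with support \<open>F\<close>\<close>

context
  fixes F :: "'a set" and w :: "'a \<Rightarrow> nat"
  assumes F: "F \<subseteq> E" and pos: "\<And>e. e \<in> F \<Longrightarrow> w e > 0" and zero: "\<And>e. e \<in> E - F \<Longrightarrow> w e = 0"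
begin

interpretation R: matroid F "restriction \<B> F"
  using F by (rule matroid_restriction)

lemma sum_basis_support:
  assumes "B \<in> \<B>"
  shows "(\<Sum>e\<in>B. w e) = (\<Sum>e\<in>B \<inter> F. w e)"
proof (rule sum.mono_neutral_right)
  show "\<forall>e\<in>B - B \<inter> F. w e = 0"
    using zero bases_subset[OF assms] by blast
qed (use assms finite_basis in auto)

text \<open>Extending \<open>I\<close> to a basis of \<open>M|F\<close> only adds elements of
  positive weight, and at least one if \<open>I\<close> is not yet a basis.\<close>

lemma sum_indep_le_wt_restriction:
  assumes "indep \<B> I" "I \<subseteq> F"
  shows "(\<Sum>e\<in>I. w e) \<le> wt (restriction \<B> F) w"
    and "card I \<noteq> rk \<B> F \<Longrightarrow> (\<Sum>e\<in>I. w e) < wt (restriction \<B> F) w"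
proof -
  obtain J where J: "indep \<B> J" "I \<subseteq> J" "J \<subseteq> F" "card J = rk \<B> F"
    using indep_extend_within[OF assms] .
  then have "(\<Sum>e\<in>J. w e) \<le> wt (restriction \<B> F) w"
    by (intro wt_ge R.finite_bases) (simp add: restriction_iff)
  moreover have "(\<Sum>e\<in>I. w e) \<le> (\<Sum>e\<in>J. w e)"
    using J finite_indep by (intro sum_mono2) auto
  moreover have "(\<Sum>e\<in>I. w e) < (\<Sum>e\<in>J. w e)" if "card I \<noteq> rk \<B> F"
  proof -
    have "I \<noteq> J"
      using J(4) that by auto
    then obtain e where "e \<in> J - I"
      using J(2) by blast
    then show ?thesis
      using J finite_indep pos by (intro sum_strict_mono2[of J I e]) auto
  qed
  ultimately show "(\<Sum>e\<in>I. w e) \<le> wt (restriction \<B> F) w"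
    "card I \<noteq> rk \<B> F \<Longrightarrow> (\<Sum>e\<in>I. w e) < wt (restriction \<B> F) w"
    by linarith+
qed

lemma wt_restriction_support: "wt \<B> w = wt (restriction \<B> F) w"
proof (rule antisym)
  have "(\<Sum>e\<in>B. w e) \<le> wt (restriction \<B> F) w" if "B \<in> \<B>" for B
    using that sum_indep_le_wt_restriction(1)[of "B \<inter> F"]
    by (auto simp: sum_basis_support indep_def)
  then show "wt \<B> w \<le> wt (restriction \<B> F) w"
    unfolding wt_def[of \<B>] using finite_bases bases_nonempty by simp
  have "(\<Sum>e\<in>J. w e) \<le> wt \<B> w" if "J \<in> restriction \<B> F" for J
    using that wt_ge[OF finite_bases, of _ w] by (auto simp: restriction_def sum_basis_support)
  then show "wt (restriction \<B> F) w \<le> wt \<B> w"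
    unfolding wt_def[of "restriction \<B> F"] using R.finite_bases R.bases_nonempty by simp
qed

text \<open>A basis whose trace on \<open>F\<close> is not of full rank is strictly lighter than the
  maximum, so maximality is decided by the trace alone.\<close>

lemma max_bases_restriction_support:
  "max_bases \<B> w = {B \<in> \<B>. B \<inter> F \<in> max_bases (restriction \<B> F) w}"
proof -
  have "B \<inter> F \<in> restriction \<B> F"
    if "B \<in> \<B>" "(\<Sum>e\<in>B \<inter> F. w e) = wt (restriction \<B> F) w" for B
    using that sum_indep_le_wt_restriction(2)[of "B \<inter> F"]
    by (fastforce simp: restriction_iff indep_def)
  then show ?thesis
    by (auto simp: max_bases_def wt_restriction_support sum_basis_support)
qed

text \<open>The rank formula of the direct sum of \<open>(M|F)_w\<close> and \<open>M/F\<close>: the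
  last difference is the rank of \<open>A - F\<close> in the contraction. Splitting a basis along
  \<open>F\<close> gives the upper bound.\<close>

lemma rk_max_bases:
  assumes "A \<subseteq> E"
  shows "rk (max_bases \<B> w) A =
    rk (max_bases (restriction \<B> F) w) (A \<inter> F) + (rk \<B> (A \<union> F) - rk \<B> F)"
proof -
  let ?R = "restriction \<B> F"
  have fam: "finite (max_bases \<B> w)" "max_bases \<B> w \<noteq> {}" "\<And>B. B \<in> max_bases \<B> w \<Longrightarrow> finite B"
    "finite (max_bases ?R w)" "max_bases ?R w \<noteq> {}" "\<And>B. B \<in> max_bases ?R w \<Longrightarrow> finite B"
    using finite_bases finite_basis R.finite_bases R.finite_basis
      max_bases_nonempty[OF finite_bases bases_nonempty]
      max_bases_nonempty[OF R.finite_bases R.bases_nonempty]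
    by (auto simp: max_bases_def)
  have split: "card (B \<inter> (A \<union> F)) = card (B \<inter> F) + card ((B - F) \<inter> A) \<and>
      card (B \<inter> A) = card (B \<inter> F \<inter> (A \<inter> F)) + card ((B - F) \<inter> A)" if "finite B" for B
  proof -
    have "B \<inter> (A \<union> F) \<inter> F = B \<inter> F" "B \<inter> (A \<union> F) - F = (B - F) \<inter> A"
      "B \<inter> A \<inter> F = B \<inter> F \<inter> (A \<inter> F)" "B \<inter> A - F = (B - F) \<inter> A"
      by blast+
    then show ?thesis
      using card_Int_Diff[of "B \<inter> (A \<union> F)" F] card_Int_Diff[of "B \<inter> A" F] that by simp
  qed
  show ?thesis
  proof (rule antisym)
    obtain B where B: "B \<in> max_bases \<B> w" "card (B \<inter> A) = rk (max_bases \<B> w) A"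
      using rk_attained fam(1-3) by metis
    then have B': "B \<in> \<B>" "B \<inter> F \<in> max_bases ?R w"
      by (simp_all add: max_bases_restriction_support)
    have "card (B \<inter> F \<inter> (A \<inter> F)) \<le> rk (max_bases ?R w) (A \<inter> F)"
      by (rule card_Int_le_rk[OF fam(4,6) B'(2)])
    moreover have "card (B \<inter> (A \<union> F)) \<le> rk \<B> (A \<union> F)"
      by (rule card_Int_le_rk[OF finite_bases finite_basis B'(1)])
    moreover have "card (B \<inter> F) = rk \<B> F"
      using B'(2) by (simp add: max_bases_def restriction_iff)
    ultimately show "rk (max_bases \<B> w) A \<le>
        rk (max_bases ?R w) (A \<inter> F) + (rk \<B> (A \<union> F) - rk \<B> F)"
      using B split[OF finite_basis[OF B'(1)]] by linarith
  next
    \<comment> \<open>For the lower bound an optimal \<open>J\<close> in \<open>F\<close> is first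
      enlarged to full rank within \<open>A \<union> F\<close> and then completed to a basis, so
      both summands are attained at once.\<close>
    obtain J where J: "J \<in> max_bases ?R w" "card (J \<inter> (A \<inter> F)) = rk (max_bases ?R w) (A \<inter> F)"
      using rk_attained fam(4-6) by metis
    then have JR: "J \<in> ?R" "J \<subseteq> F"
      by (auto simp: max_bases_def restriction_iff)
    obtain K where K: "indep \<B> K" "J \<subseteq> K" "K \<subseteq> A \<union> F" "card K = rk \<B> (A \<union> F)"
      using indep_extend_within[of J "A \<union> F"] JR by (auto simp: restriction_iff)
    obtain B where B: "B \<in> \<B>" "K \<subseteq> B"
      using K by (auto simp: indep_def)
    have "J \<subseteq> B \<inter> F"
      using B(2) K(2) JR(2) by blast
    moreover have "card (B \<inter> F) \<le> card J"
      using JR(1) card_Int_le_rk[OF finite_bases finite_basis B(1)] by (simp add: restriction_iff)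
    \<comment> \<open>\<open>J\<close> already has \<open>rk F\<close> elements, so the completion
      adds nothing inside \<open>F\<close>.\<close>
    ultimately have BF: "B \<inter> F = J"
      using finite_basis[OF B(1)] card_seteq[of "B \<inter> F" J] by simp
    then have "B \<in> max_bases \<B> w"
      using B(1) J(1) by (simp add: max_bases_restriction_support)
    then have "card (B \<inter> A) \<le> rk (max_bases \<B> w) A"
      using card_Int_le_rk[of "max_bases \<B> w"] fam(1,3) by simp
    moreover have "card K \<le> card (B \<inter> (A \<union> F))"
      using K(3) B(2) finite_basis[OF B(1)] by (intro card_mono) auto
    moreover have "card J = rk \<B> F"
      using JR(1) by (simp add: restriction_iff)
    ultimately show "rk (max_bases ?R w) (A \<inter> F) + (rk \<B> (A \<union> F) - rk \<B> F) \<le>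
        rk (max_bases \<B> w) A"
      using J(2) K(4) BF split[OF finite_basis[OF B(1)]] by simp
  qed
qed

end

end

section \<open>Characteristic polynomials of contractions\<close>

lemma sum_Pow_insert:
  assumes "finite A" "a \<notin> A"
  shows "(\<Sum>F\<in>Pow (insert a A). g F) = (\<Sum>F\<in>Pow A. g F) + (\<Sum>F\<in>Pow A. g (insert a F))"
proof -
  have "inj_on (insert a) (Pow A)"
    using assms(2) by (auto intro!: inj_onI)
  then show ?thesis
    using assms by (subst Pow_insert, subst sum.union_disjoint) (auto simp: sum.reindex)
qed

lemma sum_Pow_alternating:
  assumes "finite A"
  shows "(\<Sum>F\<in>Pow A. (- 1) ^ card F) = (if A = {} then 1 else 0 :: int)"
  using assms
proof induction
  case (insert a A)
  have "card (insert a F) = Suc (card F)" if "F \<in> Pow A" for F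
    using that insert.hyps finite_subset by (subst card_insert_disjoint) auto
  then show ?case
    using insert.hyps by (simp add: sum_Pow_insert sum_negf del: Pow_insert)
qed simp

lemma sum_Pow_alternating_Diff:
  assumes "finite A"
  shows "(\<Sum>F\<in>Pow A. (- 1) ^ card (A - F)) = (if A = {} then 1 else 0 :: int)"
proof -
  have "(\<Sum>F\<in>Pow A. (- 1) ^ card (A - F)) = (\<Sum>F\<in>Pow A. (- 1) ^ card F :: int)"
    by (rule sum.reindex_bij_witness[of _ "\<lambda>F. A - F" "\<lambda>F. A - F"]) auto
  then show ?thesis
    using sum_Pow_alternating[OF assms] by simp
qed

text \<open>Pairing \<open>F\<close> with \<open>insert a F\<close> leaves the alternating sum over
  subsets of the remaining elements, which vanishes unless nothing remains.\<close>

lemma sum_Pow_card_alternating_Diff: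
  assumes "finite A"
  shows "(\<Sum>F\<in>Pow A. int (card F) * (- 1) ^ card (A - F)) = (if card A = 1 then 1 else 0)"
proof (cases "A = {}")
  case False
  then obtain a B where A: "A = insert a B" "a \<notin> B"
    by (meson Set.set_insert ex_in_conv)
  have B: "finite B"
    using assms A by simp
  have ins: "card (insert a F) = Suc (card F)" "card (insert a B - F) = Suc (card (B - F))"
    "insert a B - insert a F = B - F" if "F \<in> Pow B" for F
  proof -
    have F: "F \<subseteq> B" "finite F" "a \<notin> F"
      using that A(2) B finite_subset by auto
    then show "card (insert a F) = Suc (card F)" "card (insert a B - F) = Suc (card (B - F))"
      "insert a B - insert a F = B - F"
      using A(2) B by (auto simp: insert_Diff_if)
  qed
  have "(\<Sum>F\<in>Pow A. int (card F) * (- 1) ^ card (A - F)) = (\<Sum>F\<in>Pow B. (- 1) ^ card (B - F))"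
    unfolding A(1) sum_Pow_insert[OF B A(2)] sum.distrib[symmetric]
    by (rule sum.cong[OF refl]) (simp add: ins A(2) Diff_insert0 algebra_simps)
  also have "\<dots> = (if card A = 1 then 1 else 0)"
    using sum_Pow_alternating_Diff[OF B] A B by auto
  finally show ?thesis .
qed simp

text \<open>The characteristic polynomial of \<open>M/F\<close>.\<close>

definition contraction_poly :: "'a set \<Rightarrow> 'a set set \<Rightarrow> 'a set \<Rightarrow> int poly" where
  "contraction_poly E \<B> F =
    (\<Sum>A\<in>Pow (E - F). monom ((- 1) ^ card A) (rk \<B> E - rk \<B> (A \<union> F)))"

text \<open>At 1 only the signs remain, and they cancel over the subsets of the nonempty
  \<open>E - F\<close>.\<close>

lemma poly_contraction_poly_1:
  assumes "finite E" "F \<subset> E"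
  shows "poly (contraction_poly E \<B> F) 1 = 0"
  using assms sum_Pow_alternating[of "E - F"] by (auto simp: contraction_poly_def poly_sum poly_monom)

lemma contraction_poly_ground: "contraction_poly E \<B> E = 1"
  by (simp add: contraction_poly_def monom_0)

section \<open>Derivatives at 1 and the product formula\<close>

context matroid
begin

lemma pderiv_contraction_poly_1:
  "poly (pderiv (contraction_poly E \<B> F)) 1 =
    (\<Sum>A\<in>Pow (E - F). (- 1) ^ card A * int (rk \<B> E - rk \<B> (A \<union> F)))"
  by (simp add: contraction_poly_def higher_pderiv_sum[of 1, simplified] poly_sum pderiv_monom poly_monom mult.commute)

text \<open>Summing over the union of \<open>A\<close> and \<open>F\<close> first isolates an
  alternating sum over \<open>F\<close>, evaluated below for \<open>c F\<close> equal to 1 and to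
  the size of \<open>F\<close>.\<close>

lemma sum_pderiv_contraction_poly:
  "(\<Sum>F\<in>Pow E. c F * poly (pderiv (contraction_poly E \<B> F)) 1) =
    (\<Sum>A\<in>Pow E. int (rk \<B> E - rk \<B> A) * (\<Sum>F\<in>Pow A. c F * (- 1) ^ card (A - F)))"
proof -
  have diff: "A - F = A" if "A \<subseteq> E - F" for A F
    using that by blast
  have "(\<Sum>F\<in>Pow E. c F * poly (pderiv (contraction_poly E \<B> F)) 1) =
      (\<Sum>(F, A)\<in>(SIGMA F:Pow E. Pow (E - F)). c F * ((- 1) ^ card A * int (rk \<B> E - rk \<B> (A \<union> F))))"
    using finite_ground by (simp add: pderiv_contraction_poly_1 sum_distrib_left sum.Sigma)
  also have "\<dots> = (\<Sum>(A, F)\<in>(SIGMA A:Pow E. Pow A). int (rk \<B> E - rk \<B> A) * (c F * (- 1) ^ card (A - F)))"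
    by (rule sum.reindex_bij_witness[of _ "\<lambda>(A, F). (F, A - F)" "\<lambda>(F, A). (A \<union> F, F)"])
      (auto simp: Un_Diff Un_absorb2 diff ac_simps)
  also have "\<dots> = (\<Sum>A\<in>Pow E. int (rk \<B> E - rk \<B> A) * (\<Sum>F\<in>Pow A. c F * (- 1) ^ card (A - F)))"
    using finite_ground finite_subset[of _ E]
    by (subst sum.Sigma[symmetric]) (auto simp: sum_distrib_left)
  finally show ?thesis .
qed

lemma rk_empty: "rk \<B> {} = 0"
  by (simp add: rk_eq_Max[OF bases_family] image_constant_conv bases_nonempty)

text \<open>Only the empty set, of rank 0, survives the inner alternating sum.\<close>

lemma sum_pderiv_contraction_poly_1:
  "(\<Sum>F\<in>Pow E. poly (pderiv (contraction_poly E \<B> F)) 1) = int (rk \<B> E)"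
proof -
  have "(\<Sum>F\<in>Pow E. 1 * poly (pderiv (contraction_poly E \<B> F)) 1) =
    (\<Sum>A\<in>Pow E. int (rk \<B> E - rk \<B> A) * (if A = {} then 1 else 0))"
    unfolding sum_pderiv_contraction_poly
    using finite_ground finite_subset[of _ E]
    by (intro sum.cong) (auto simp: sum_Pow_alternating_Diff)
  also have "\<dots> = int (rk \<B> E)"
    using finite_ground by (simp add: if_distrib[of "\<lambda>x. _ * x"] rk_empty sum.delta cong: if_cong)
  finally show ?thesis
    by simp
qed

lemma rk_singleton:
  assumes "loopless E \<B>" "e \<in> E"
  shows "rk \<B> {e} = 1"
proof (rule antisym)
  show "1 \<le> rk \<B> {e}"
    using assms card_indep_le_rk[of "{e}" "{e}"] by (simp add: loopless_def)
  obtain B where "card (B \<inter> {e}) = rk \<B> {e}"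
    using rk_attained bases_family by metis
  then show "rk \<B> {e} \<le> 1"
    using card_mono[of "{e}" "B \<inter> {e}"] by simp
qed

text \<open>Only singletons survive, and looplessness gives each of them corank
  \<open>rk E - 1\<close>.\<close>

lemma sum_card_pderiv_contraction_poly:
  assumes "loopless E \<B>"
  shows "(\<Sum>F\<in>Pow E. int (card F) * poly (pderiv (contraction_poly E \<B> F)) 1) =
    int (card E) * int (rk \<B> E - 1)"
proof -
  have "(\<Sum>F\<in>Pow E. int (card F) * poly (pderiv (contraction_poly E \<B> F)) 1) =
    (\<Sum>A\<in>Pow E. int (rk \<B> E - rk \<B> A) * (if card A = 1 then 1 else 0))"
    unfolding sum_pderiv_contraction_poly
    using finite_ground finite_subset[of _ E]
    by (intro sum.cong) (auto simp: sum_Pow_card_alternating_Diff)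
  also have "\<dots> = (\<Sum>A\<in>(\<lambda>e. {e}) ` E. int (rk \<B> E - rk \<B> A))"
    using finite_ground by (intro sum.mono_neutral_cong_right) (auto simp: card_1_singleton_iff)
  also have "\<dots> = (\<Sum>e\<in>E. int (rk \<B> E - 1))"
    using rk_singleton[OF assms] by (subst sum.reindex) auto
  finally show ?thesis
    by simp
qed

lemma rk_pos:
  assumes "loopless E \<B>" "E \<noteq> {}"
  shows "rk \<B> E > 0"
proof -
  obtain e where "e \<in> E"
    using assms by blast
  then have "1 \<le> rk \<B> E"
    using rk_singleton[OF assms(1)] rk_mono[OF bases_family, of "{e}" E] by simp
  then show ?thesis
    by simp
qed

text \<open>In the direct sum of \<open>(M|F)_w\<close> and \<open>M/F\<close>, subsets split along
  \<open>F\<close>, signs multiply and coranks add.\<close>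

lemma char_poly_max_bases:
  fixes w :: "'a \<Rightarrow> nat"
  assumes F: "F \<subseteq> E" "\<And>e. e \<in> F \<Longrightarrow> w e > 0" "\<And>e. e \<in> E - F \<Longrightarrow> w e = 0"
  shows "char_poly E (max_bases \<B> w) =
    char_poly F (max_bases (restriction \<B> F) w) * contraction_poly E \<B> F"
proof -
  interpret R: matroid F "restriction \<B> F"
    using F(1) by (rule matroid_restriction)
  let ?M = "max_bases \<B> w" and ?R = "max_bases (restriction \<B> F) w"
  have fam: "finite ?R" "?R \<noteq> {}" "\<And>B. B \<in> ?R \<Longrightarrow> finite B"
    using R.finite_bases R.finite_basis max_bases_nonempty[OF R.finite_bases R.bases_nonempty]
    by (auto simp: max_bases_def)
  have rk: "rk ?M E - rk ?M (A1 \<union> A2) = (rk ?R F - rk ?R A1) + (rk \<B> E - rk \<B> (A2 \<union> F))"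
    if A: "A1 \<subseteq> F" "A2 \<subseteq> E - F" for A1 A2
  proof -
    have sets: "(A1 \<union> A2) \<inter> F = A1" "A1 \<union> A2 \<union> F = A2 \<union> F" "E \<inter> F = F" "E \<union> F = E"
      using A F(1) by blast+
    have "rk ?M E = rk ?R F + (rk \<B> E - rk \<B> F)"
      using rk_max_bases[OF F, where A = E] by (simp add: sets)
    moreover have "rk ?M (A1 \<union> A2) = rk ?R A1 + (rk \<B> (A2 \<union> F) - rk \<B> F)"
      using rk_max_bases[OF F, where A = "A1 \<union> A2"] A F(1) by (simp add: sets le_supI subset_iff)
    \<comment> \<open>Monotonicity of the rank makes the truncated subtractions exact.\<close>
    moreover have "rk ?R A1 \<le> rk ?R F" "rk \<B> F \<le> rk \<B> (A2 \<union> F)" "rk \<B> (A2 \<union> F) \<le> rk \<B> E"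
      using A F(1) by (auto intro: rk_mono[OF fam] rk_mono[OF bases_family])
    ultimately show ?thesis
      by linarith
  qed
  have "char_poly F ?R * contraction_poly E \<B> F =
      (\<Sum>(A1, A2)\<in>Pow F \<times> Pow (E - F). monom ((- 1) ^ card A1) (rk ?R F - rk ?R A1) *
        monom ((- 1) ^ card A2) (rk \<B> E - rk \<B> (A2 \<union> F)))"
    by (simp add: char_poly_def contraction_poly_def sum_product sum.cartesian_product)
  also have "\<dots> = (\<Sum>(A1, A2)\<in>Pow F \<times> Pow (E - F).
      monom ((- 1) ^ card (A1 \<union> A2)) (rk ?M E - rk ?M (A1 \<union> A2)))"
  proof (intro sum.cong refl, clarify)
    fix A1 A2 assume A: "A1 \<subseteq> F" "A2 \<subseteq> E - F"
    have "card (A1 \<union> A2) = card A1 + card A2"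
      using A F(1) finite_ground by (intro card_Un_disjoint) (auto intro: finite_subset)
    then show "monom ((- 1 :: int) ^ card A1) (rk ?R F - rk ?R A1) *
        monom ((- 1) ^ card A2) (rk \<B> E - rk \<B> (A2 \<union> F)) =
        monom ((- 1) ^ card (A1 \<union> A2)) (rk ?M E - rk ?M (A1 \<union> A2))"
      using rk[OF A] by (simp add: mult_monom power_add)
  qed
  also have "\<dots> = char_poly E ?M"
    unfolding char_poly_def using F(1)
    by (intro sum.reindex_bij_witness[of _ "\<lambda>A. (A \<inter> F, A - F)" "\<lambda>(A1, A2). A1 \<union> A2"]) auto
  finally show ?thesis
    by simp
qed

end

section \<open>Decomposition by support\<close>

definition weights :: "'a set \<Rightarrow> nat \<Rightarrow> ('a \<Rightarrow> nat) set" where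
  "weights E n = {w \<in> E \<rightarrow>\<^sub>E UNIV. (\<Sum>e\<in>E. w e) = n}"

lemma finite_weights:
  assumes "finite E"
  shows "finite (weights E n)"
proof (rule finite_subset)
  show "weights E n \<subseteq> E \<rightarrow>\<^sub>E {..n}"
    unfolding weights_def PiE_iff using assms by (auto simp: extensional_def intro: member_le_sum)
  show "finite (E \<rightarrow>\<^sub>E {..n})"
    using assms by (simp add: finite_PiE)
qed

text \<open>Adding one on \<open>F\<close> matches arbitrary weights on \<open>F\<close> with the
  weights on \<open>E\<close> whose support is exactly \<open>F\<close>.\<close>

definition support_extend :: "'a set \<Rightarrow> 'a set \<Rightarrow> ('a \<Rightarrow> nat) \<Rightarrow> 'a \<Rightarrow> nat" where
  "support_extend E F w = (\<lambda>e\<in>E. if e \<in> F then Suc (w e) else 0)"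

lemma sum_support_extend:
  assumes "finite E" "F \<subseteq> E"
  shows "(\<Sum>e\<in>E. support_extend E F w e) = (\<Sum>e\<in>F. w e) + card F"
proof -
  have "(\<Sum>e\<in>E. support_extend E F w e) = (\<Sum>e\<in>E. if e \<in> F then Suc (w e) else 0)"
    by (simp add: support_extend_def)
  also have "\<dots> = (\<Sum>e\<in>F. Suc (w e))"
    using assms by (simp add: Int_absorb1 flip: sum.inter_restrict)
  finally show ?thesis
    by (simp add: sum_Suc)
qed

text \<open>A weight with support \<open>F\<close> has total at least \<open>card F\<close>; without
  the case split the truncated \<open>n - card F\<close> would add spurious terms.\<close>

lemma sum_weights_by_support:
  assumes "finite E"
  shows "(\<Sum>w\<in>weights E n. f w) =
    (\<Sum>F\<in>Pow E. if n < card F then 0 else \<Sum>w\<in>weights F (n - card F). f (support_extend E F w))"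
proof -
  have "(\<Sum>w\<in>weights E n. f w) =
      (\<Sum>F\<in>Pow E. \<Sum>w\<in>{w \<in> weights E n. {e\<in>E. w e > 0} = F}. f w)"
    using finite_weights[OF assms] assms by (intro sum.group[symmetric]) auto
  also have "\<dots> =
    (\<Sum>F\<in>Pow E. if n < card F then 0 else \<Sum>w\<in>weights F (n - card F). f (support_extend E F w))"
  proof (rule sum.cong[OF refl])
    fix F assume "F \<in> Pow E"
    then have F: "F \<subseteq> E"
      by simp
    have extend: "w = support_extend E F (\<lambda>e\<in>F. w e - 1)"
      if "w \<in> weights E n" "{e\<in>E. w e > 0} = F" for w
      using that by (auto simp: fun_eq_iff weights_def PiE_iff extensional_def support_extend_def)
    have sum: "(\<Sum>e\<in>F. (\<lambda>e\<in>F. w e - 1) e) + card F = n"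
      if "w \<in> weights E n" "{e\<in>E. w e > 0} = F" for w
    proof -
      have "(\<Sum>e\<in>E. support_extend E F (\<lambda>e\<in>F. w e - 1) e) = n"
        using that(1) by (subst extend[OF that, symmetric]) (simp add: weights_def)
      then show ?thesis
        using sum_support_extend[OF assms F] by metis
    qed
    show "(\<Sum>w\<in>{w \<in> weights E n. {e\<in>E. w e > 0} = F}. f w) =
        (if n < card F then 0 else \<Sum>w\<in>weights F (n - card F). f (support_extend E F w))"
    proof (cases "n < card F")
      case True
      then have "{w \<in> weights E n. {e\<in>E. w e > 0} = F} = {}"
        using sum by fastforce
      then show ?thesis
        using True by (simp only: sum.empty if_True)
    next
      case False
      have "(\<Sum>w\<in>{w \<in> weights E n. {e\<in>E. w e > 0} = F}. f w) =
          (\<Sum>w\<in>weights F (n - card F). f (support_extend E F w))"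
      proof (rule sum.reindex_bij_witness[of _ "support_extend E F" "\<lambda>w. \<lambda>e\<in>F. w e - 1"])
        fix w assume w: "w \<in> {w \<in> weights E n. {e\<in>E. w e > 0} = F}"
        show "support_extend E F (\<lambda>e\<in>F. w e - 1) = w" "f (support_extend E F (\<lambda>e\<in>F. w e - 1)) = f w"
          using extend[of w] w by simp_all
        have "(\<Sum>e\<in>F. (\<lambda>e\<in>F. w e - 1) e) = n - card F"
          using sum[of w] w by simp
        then show "(\<lambda>e\<in>F. w e - 1) \<in> weights F (n - card F)"
          by (simp add: weights_def)
      next
        fix w assume w: "w \<in> weights F (n - card F)"
        show "(\<lambda>e\<in>F. support_extend E F w e - 1) = w"
          using w F by (auto simp: fun_eq_iff weights_def PiE_iff extensional_def support_extend_def)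
        have "(\<Sum>e\<in>E. support_extend E F w e) = n"
          using w False by (simp add: sum_support_extend[OF assms F] weights_def)
        moreover have "{e \<in> E. support_extend E F w e > 0} = F"
          using F by (auto simp: support_extend_def)
        moreover have "support_extend E F w \<in> extensional E"
          by (simp add: support_extend_def)
        ultimately show "support_extend E F w \<in> {w \<in> weights E n. {e\<in>E. w e > 0} = F}"
          by (simp add: weights_def PiE_def)
      qed
      then show ?thesis
        using False by simp
    qed
  qed
  finally show ?thesis .
qed

definition poly_at_q :: "int poly \<Rightarrow> laurent" where
  "poly_at_q p = poly (map_poly of_int p) (q_pow 1)"

lemma poly_at_q_mult: "poly_at_q (p * q) = poly_at_q p * poly_at_q q"
  unfolding poly_at_q_def by (subst map_poly_hom_mult) simp_all

lemma poly_at_q_1: "poly_at_q 1 = 1"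
  by (simp add: poly_at_q_def)

lemma zeta_nth:
  "zeta E \<B> $ n = (\<Sum>w\<in>weights E n.
     poly_at_q (char_poly E (max_bases \<B> w)) * q_pow (- int (rk \<B> E) - int (wt \<B> w)))"
  by (simp add: zeta_def weights_def poly_at_q_def)

context matroid
begin

text \<open>Support \<open>F\<close> contributes the weights of \<open>M|F\<close> raised by one,
  whence \<open>T^|F|\<close>. The term for \<open>F = E\<close> contains \<open>zeta E \<B>\<close>
  again, so this is a linear equation for it.\<close>

lemma zeta_by_support:
  "zeta E \<B> = (\<Sum>F\<in>Pow E. fps_const (poly_at_q (contraction_poly E \<B> F) * q_pow (- int (rk \<B> E))) *
     fps_X ^ card F * zeta F (restriction \<B> F))"
proof (rule fps_ext)
  fix n
  define t where "t w = poly_at_q (char_poly E (max_bases \<B> w)) *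
    q_pow (- int (rk \<B> E) - int (wt \<B> w))" for w :: "'a \<Rightarrow> nat"
  have t: "t (support_extend E F w) = poly_at_q (contraction_poly E \<B> F) * q_pow (- int (rk \<B> E)) *
      (poly_at_q (char_poly F (max_bases (restriction \<B> F) w)) *
       q_pow (- int (rk (restriction \<B> F) F) - int (wt (restriction \<B> F) w)))"
    if F: "F \<subseteq> E" for F w
  proof -
    interpret R: matroid F "restriction \<B> F"
      using F by (rule matroid_restriction)
    let ?w = "support_extend E F w"
    have w: "\<And>e. e \<in> F \<Longrightarrow> ?w e > 0" "\<And>e. e \<in> E - F \<Longrightarrow> ?w e = 0"
      using F by (auto simp: support_extend_def)
    have shift: "(\<Sum>e\<in>J. ?w e) = (\<Sum>e\<in>J. w e) + rk \<B> F" if "J \<in> restriction \<B> F" for J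
    proof -
      have "J \<subseteq> F" "card J = rk \<B> F"
        using that by (simp_all add: restriction_iff)
      moreover from this(1) F have "(\<Sum>e\<in>J. ?w e) = (\<Sum>e\<in>J. Suc (w e))"
        by (intro sum.cong) (auto simp: support_extend_def)
      ultimately show ?thesis
        by (simp add: sum_Suc)
    qed
    note wt = wt_shift(1)[OF R.finite_bases R.bases_nonempty shift]
      and bases = wt_shift(2)[OF R.finite_bases R.bases_nonempty shift]
    \<comment> \<open>Raising the entries adds \<open>rk F\<close> to the weight, which is exactly
      the normalizing exponent in the zeta function of \<open>M|F\<close>.\<close>
    have "- int (rk \<B> E) - int (wt \<B> ?w) =
        - int (rk \<B> E) + (- int (rk (restriction \<B> F) F) - int (wt (restriction \<B> F) w))"
      using wt wt_restriction_support[OF F w] rk_restriction[OF F] by simp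
    moreover have "char_poly E (max_bases \<B> ?w) =
        char_poly F (max_bases (restriction \<B> F) w) * contraction_poly E \<B> F"
      using char_poly_max_bases[OF F w] bases by simp
    ultimately show ?thesis
      by (simp only: t_def poly_at_q_mult q_pow_add ac_simps)
  qed
  have "zeta E \<B> $ n = (\<Sum>F\<in>Pow E. if n < card F then 0
      else \<Sum>w\<in>weights F (n - card F). t (support_extend E F w))"
    unfolding zeta_nth t_def[symmetric] by (rule sum_weights_by_support[OF finite_ground])
  also have "\<dots> = (\<Sum>F\<in>Pow E. if n < card F then 0 else
      poly_at_q (contraction_poly E \<B> F) * q_pow (- int (rk \<B> E)) *
      zeta F (restriction \<B> F) $ (n - card F))"
    by (intro sum.cong refl if_cong) (simp add: t zeta_nth sum_distrib_left)
  also have "\<dots> = (\<Sum>F\<in>Pow E. fps_const (poly_at_q (contraction_poly E \<B> F) *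
      q_pow (- int (rk \<B> E))) * fps_X ^ card F * zeta F (restriction \<B> F)) $ n"
    by (simp only: fps_sum_nth mult.assoc fps_mult_left_const_nth fps_X_power_mult_nth
        if_distrib[of "\<lambda>x. _ * x"] mult_zero_right)
  finally show "zeta E \<B> $ n = \<dots>" .
qed

end

section \<open>Jets of rational functions\<close>

text \<open>\<open>r = a + b s + O(s\<^sup>2)\<close>, with denominators cleared.\<close>

definition jet :: "ratfun \<Rightarrow> rat \<Rightarrow> rat \<Rightarrow> bool" where
  "jet r a b \<longleftrightarrow> (\<exists>p d. r = Fract p d \<and> poly d 0 \<noteq> 0 \<and> poly p 0 = a * poly d 0 \<and>
     poly (pderiv p) 0 = b * poly d 0 + a * poly (pderiv d) 0)"

lemma jet_eval:
  assumes "jet r a b"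
  shows "ratfun_eval r 0 = a" and "ratfun_eval (ratfun_deriv r) 0 = b"
proof -
  obtain p d where r: "r = Fract p d" and d: "poly d 0 \<noteq> 0" "poly p 0 = a * poly d 0"
    "poly (pderiv p) 0 = b * poly d 0 + a * poly (pderiv d) 0"
    using assms by (auto simp: jet_def)
  then have "d \<noteq> 0"
    by auto
  show "ratfun_eval r 0 = a"
    using d by (simp add: r ratfun_eval_Fract)
  have "ratfun_eval (ratfun_deriv r) 0 =
      (poly (pderiv p) 0 * poly d 0 - poly p 0 * poly (pderiv d) 0) / poly d 0 ^ 2"
    using d(1) by (simp add: r ratfun_deriv_Fract[OF \<open>d \<noteq> 0\<close>] ratfun_eval_Fract)
  also have "\<dots> = b"
    using d by (simp add: field_simps power2_eq_square)
  finally show "ratfun_eval (ratfun_deriv r) 0 = b" .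
qed

section \<open>Arithmetic of jets\<close>

lemma jet_0: "jet 0 0 0"
  unfolding jet_def by (intro exI[of _ 0] exI[of _ 1]) (simp add: Zero_fract_def)

lemma jet_1: "jet 1 1 0"
  unfolding jet_def by (intro exI[of _ 1]) (simp add: One_fract_def)

lemma jet_add:
  assumes "jet r a b" "jet r' a' b'"
  shows "jet (r + r') (a + a') (b + b')"
proof -
  obtain p d where 1: "r = Fract p d" "poly d 0 \<noteq> 0" "poly p 0 = a * poly d 0"
    "poly (pderiv p) 0 = b * poly d 0 + a * poly (pderiv d) 0"
    using assms by (auto simp: jet_def)
  obtain p' d' where 2: "r' = Fract p' d'" "poly d' 0 \<noteq> 0" "poly p' 0 = a' * poly d' 0"
    "poly (pderiv p') 0 = b' * poly d' 0 + a' * poly (pderiv d') 0"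
    using assms by (auto simp: jet_def)
  have "r + r' = Fract (p * d' + p' * d) (d * d')"
    using 1(1,2) 2(1,2) by (subst 1(1), subst 2(1), subst add_fract) auto
  then show ?thesis
    unfolding jet_def using 1(2-) 2(2-)
    by (intro exI[of _ "p * d' + p' * d"] exI[of _ "d * d'"])
      (simp add: pderiv_add pderiv_mult algebra_simps)
qed

lemma jet_mult:
  assumes "jet r a b" "jet r' a' b'"
  shows "jet (r * r') (a * a') (a * b' + b * a')"
proof -
  obtain p d where 1: "r = Fract p d" "poly d 0 \<noteq> 0" "poly p 0 = a * poly d 0"
    "poly (pderiv p) 0 = b * poly d 0 + a * poly (pderiv d) 0"
    using assms by (auto simp: jet_def)
  obtain p' d' where 2: "r' = Fract p' d'" "poly d' 0 \<noteq> 0" "poly p' 0 = a' * poly d' 0"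
    "poly (pderiv p') 0 = b' * poly d' 0 + a' * poly (pderiv d') 0"
    using assms by (auto simp: jet_def)
  have "r * r' = Fract (p * p') (d * d')"
    by (simp add: 1(1) 2(1))
  then show ?thesis
    unfolding jet_def using 1(2-) 2(2-)
    by (intro exI[of _ "p * p'"] exI[of _ "d * d'"]) (simp add: pderiv_mult algebra_simps)
qed

lemma jet_sum:
  assumes "\<And>i. i \<in> A \<Longrightarrow> jet (r i) (a i) (b i)"
  shows "jet (\<Sum>i\<in>A. r i) (\<Sum>i\<in>A. a i) (\<Sum>i\<in>A. b i)"
  using assms by (induction A rule: infinite_finite_induct) (auto intro: jet_0 jet_add)

lemma jet_uminus: "jet r a b \<Longrightarrow> jet (- r) (- a) (- b)"
  unfolding jet_def by (metis (no_types, lifting) minus_fract minus_add_distrib mult_minus_left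
      pderiv_minus poly_minus)

lemma jet_of_int: "jet (of_int m) (of_int m) 0"
proof -
  have nat: "jet (of_nat k) (of_nat k) 0" for k
    by (induction k) (use jet_0 jet_add[OF jet_1] in auto)
  show ?thesis
    using nat jet_uminus[OF nat] by (cases m rule: int_cases2) simp_all
qed

text \<open>Geometric expansion in \<open>s\<close>; \<open>b \<noteq> 0\<close> keeps 0 from being
  a pole.\<close>

lemma jet_linear_inverse:
  assumes "b \<noteq> 0"
  shows "jet (1 / (of_nat a * ratfun_s - of_int b)) (- 1 / of_int b) (- of_nat a / of_int b ^ 2)"
proof -
  have "1 / (of_nat a * ratfun_s - of_int b) = Fract 1 [:- of_int b, of_nat a:]"
    unfolding ratfun_linear by (simp add: divide_fract One_fract_def)
  then show ?thesis
    unfolding jet_def using assms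
    by (intro exI[of _ 1] exI[of _ "[:- of_int b, of_nat a:]"])
      (simp add: pderiv_pCons power2_eq_square field_simps)
qed

section \<open>The recursion\<close>

lemma rat_fps_sum: "(\<And>i. i \<in> A \<Longrightarrow> f i \<in> rat_fps) \<Longrightarrow> (\<Sum>i\<in>A. f i) \<in> rat_fps"
  using rat_fps.const[of 0]
  by (induction A rule: infinite_finite_induct) (auto intro: rat_fps.add)

context top_specialization
begin

lemma mu_sum: "(\<And>i. i \<in> A \<Longrightarrow> f i \<in> rat_fps) \<Longrightarrow> \<mu> (\<Sum>i\<in>A. f i) = (\<Sum>i\<in>A. \<mu> (f i))"
  by (induction A rule: infinite_finite_induct) (simp_all add: mu_0 mu_add rat_fps_sum)

end

text \<open>The sum over the weights without zero entry. The recursion is stated for it because \<open>T\<^sup>a\<close> alone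
  does not lie in the subalgebra.\<close>

definition positive_zeta :: "'a set \<Rightarrow> 'a set set \<Rightarrow> laurent fps" where
  "positive_zeta E \<B> = fps_const (q_pow (- int (rk \<B> E))) * fps_X ^ card E * zeta E \<B>"

lemma one_minus_power_neq_0:
  assumes "a > 0"
  shows "1 - fps_const c * fps_X ^ a \<noteq> (0 :: laurent fps)"
proof
  assume "1 - fps_const c * fps_X ^ a = (0 :: laurent fps)"
  then have "(1 - fps_const c * fps_X ^ a) $ 0 = (0 :: laurent)"
    by (simp only: fps_zero_nth)
  then show False
    using assms by simp
qed

text \<open>Turns a zero at 1 into the factor \<open>q - 1\<close> that the generators require; the
  product rule gives the value of the cofactor.\<close>

lemma poly_root_1_factor:
  assumes "poly p 1 = (0 :: int)"
  obtains l where "p = [:- 1, 1:] * l" "poly (pderiv p) 1 = poly l 1"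
proof -
  obtain l where l: "p = [:- 1, 1:] * l"
    using assms by (metis dvdE poly_eq_0_iff_dvd)
  then show thesis
    by (intro that[of l]) (simp_all add: pderiv_mult pderiv_pCons del: mult_pCons_left)
qed

lemma poly_at_q_linear: "poly_at_q [:- 1, 1:] = q_pow 1 - 1"
  by (simp add: poly_at_q_def map_poly_pCons)

text \<open>Pulling \<open>q - 1\<close> out of the terms with \<open>F \<noteq> E\<close> gives
  \<open>Z = Y + (q - 1) S\<close>. Since \<open>Y = c Z\<close> with
  \<open>c = q^(-rk E) T^|E|\<close>, solving for \<open>Y\<close> yields a generator times
  \<open>S\<close>.\<close>

lemma (in matroid) zeta_decomposition:
  assumes "E \<noteq> {}"
    and l: "\<And>F. F \<subset> E \<Longrightarrow> contraction_poly E \<B> F = [:- 1, 1:] * l F"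
  defines "S \<equiv> \<Sum>F\<in>Pow E - {E}. fps_const (poly_at_q (l F)) *
    (fps_const (q_pow (int (rk \<B> F) - int (rk \<B> E))) * positive_zeta F (restriction \<B> F))"
  shows "positive_zeta E \<B> = rat_gen (card E) (- int (rk \<B> E)) * S"
    and "zeta E \<B> = positive_zeta E \<B> + fps_const (q_pow 1 - 1) * S"
proof -
  let ?t = "\<lambda>F. fps_const (poly_at_q (contraction_poly E \<B> F) * q_pow (- int (rk \<B> E))) *
     fps_X ^ card F * zeta F (restriction \<B> F)"
  have n: "card E > 0"
    using assms(1) finite_ground by (simp add: card_gt_0_iff)
  have top: "?t E = positive_zeta E \<B>"
    by (simp add: positive_zeta_def contraction_poly_ground poly_at_q_1 restriction_ground)
  have "?t F = fps_const (q_pow 1 - 1) * (fps_const (poly_at_q (l F)) *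
      (fps_const (q_pow (int (rk \<B> F) - int (rk \<B> E))) * positive_zeta F (restriction \<B> F)))"
    if "F \<in> Pow E - {E}" for F
  proof -
    have F: "F \<subseteq> E" "F \<subset> E"
      using that by auto
    \<comment> \<open>The factor \<open>q^(-rk F)\<close> is absorbed into
      \<open>positive_zeta\<close> of the restriction.\<close>
    have "q_pow (- int (rk \<B> E)) = q_pow (int (rk \<B> F) - int (rk \<B> E)) * q_pow (- int (rk \<B> F))"
      by (simp flip: q_pow_add)
    then have "fps_const (poly_at_q (contraction_poly E \<B> F) * q_pow (- int (rk \<B> E))) =
      fps_const (q_pow 1 - 1) * (fps_const (poly_at_q (l F)) *
        (fps_const (q_pow (int (rk \<B> F) - int (rk \<B> E))) * fps_const (q_pow (- int (rk \<B> F)))))"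
      by (simp only: l[OF F(2)] poly_at_q_mult poly_at_q_linear fps_const_mult mult.assoc)
    then show ?thesis
      by (simp only: positive_zeta_def rk_restriction[OF F(1)] mult.assoc)
  qed
  then have "(\<Sum>F\<in>Pow E - {E}. ?t F) = fps_const (q_pow 1 - 1) * S"
    unfolding S_def sum_distrib_left by (rule sum.cong[OF refl])
  moreover have "zeta E \<B> = ?t E + (\<Sum>F\<in>Pow E - {E}. ?t F)"
    by (subst zeta_by_support, rule sum.remove) (use finite_ground in auto)
  ultimately show zeta: "zeta E \<B> = positive_zeta E \<B> + fps_const (q_pow 1 - 1) * S"
    using top by simp
  define c where "c = fps_const (q_pow (- int (rk \<B> E))) * fps_X ^ card E"
  have pz: "positive_zeta E \<B> = c * zeta E \<B>"
    by (simp add: positive_zeta_def c_def)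
  have "positive_zeta E \<B> * (1 - c) = c * (zeta E \<B> - positive_zeta E \<B>)"
    unfolding pz by (simp add: algebra_simps)
  also have "\<dots> = c * (fps_const (q_pow 1 - 1) * S)"
    using zeta by simp
  also have "\<dots> = fps_const ((q_pow 1 - 1) * q_pow (- int (rk \<B> E))) * fps_X ^ card E * S"
    unfolding c_def fps_const_mult[symmetric] by (simp only: ac_simps)
  also have "\<dots> = rat_gen (card E) (- int (rk \<B> E)) * S * (1 - c)"
    unfolding rat_gen_mult[OF n, symmetric] c_def by (simp only: ac_simps)
  finally show "positive_zeta E \<B> = rat_gen (card E) (- int (rk \<B> E)) * S"
    using one_minus_power_neq_0[OF n, of "q_pow (- int (rk \<B> E))"] unfolding c_def by simp
qed

lemma zeta_empty:
  assumes "matroid {} \<B>"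
  shows "zeta {} \<B> = 1" and "positive_zeta {} \<B> = 1"
proof -
  interpret matroid "{}" \<B>
    by fact
  have "B = {}" if "B \<in> \<B>" for B
    using bases_subset[OF that] by simp
  then have B: "\<B> = {{}}"
    using bases_nonempty by auto
  have wt: "wt \<B> w = 0" and m: "max_bases \<B> w = \<B>" for w :: "'a \<Rightarrow> nat"
    by (auto simp: B wt_def max_bases_def)
  have "char_poly {} \<B> = 1"
    by (simp add: char_poly_def)
  then show z: "zeta {} \<B> = 1"
    by (intro fps_ext)
      (simp add: zeta_nth wt m rk_empty poly_at_q_1 q_pow_0 weights_def)
  show "positive_zeta {} \<B> = 1"
    by (simp add: positive_zeta_def z rk_empty q_pow_0)
qed

text \<open>Membership is carried through the induction because \<mu> is a morphism only on the
  subalgebra. Proper restrictions stay loopless, so the recursion for \<open>Y\<close> applies to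
  them.\<close>

lemma (in top_specialization) zeta_jet:
  assumes "matroid E \<B>" "loopless E \<B>"
  shows "zeta E \<B> \<in> rat_fps \<and> positive_zeta E \<B> \<in> rat_fps \<and>
    \<mu> (zeta E \<B>) = \<mu> (positive_zeta E \<B>) \<and> jet (\<mu> (positive_zeta E \<B>)) 1 (- of_nat (card E))"
  using assms
proof (induction "card E" arbitrary: E \<B> rule: less_induct)
  case less
  interpret matroid E \<B>
    by fact
  show ?case
  proof (cases "E = {}")
    case True
    then show ?thesis
      using less.prems rat_fps.const[of 1] jet_1 by (simp add: zeta_empty mu_1)
  next
    case False
    have n: "card E > 0"
      using False finite_ground by (simp add: card_gt_0_iff)
    let ?r = "rk \<B> E"
    have r: "?r > 0"
      by (rule rk_pos[OF less.prems(2) False])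
    have "\<exists>l. contraction_poly E \<B> F = [:- 1, 1:] * l \<and>
        poly (pderiv (contraction_poly E \<B> F)) 1 = poly l 1" if "F \<subset> E" for F
      using poly_root_1_factor[OF poly_contraction_poly_1[OF finite_ground that]] by metis
    then obtain l where l: "\<And>F. F \<subset> E \<Longrightarrow> contraction_poly E \<B> F = [:- 1, 1:] * l F"
      and l1: "\<And>F. F \<subset> E \<Longrightarrow> poly (pderiv (contraction_poly E \<B> F)) 1 = poly (l F) 1"
      by metis
    let ?g = "\<lambda>F. fps_const (q_pow (int (rk \<B> F) - int ?r)) * positive_zeta F (restriction \<B> F)"
    define S where "S = (\<Sum>F\<in>Pow E - {E}. fps_const (poly_at_q (l F)) * ?g F)"
    have decomp: "positive_zeta E \<B> = rat_gen (card E) (- int ?r) * S"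
      "zeta E \<B> = positive_zeta E \<B> + fps_const (q_pow 1 - 1) * S"
      unfolding S_def using zeta_decomposition[OF False l] by simp_all
    have IH: "positive_zeta F (restriction \<B> F) \<in> rat_fps"
      "jet (\<mu> (positive_zeta F (restriction \<B> F))) 1 (- of_nat (card F))"
      if "F \<in> Pow E - {E}" for F
    proof -
      have F: "F \<subset> E" "F \<subseteq> E"
        using that by auto
      show "positive_zeta F (restriction \<B> F) \<in> rat_fps"
        "jet (\<mu> (positive_zeta F (restriction \<B> F))) 1 (- of_nat (card F))"
        using less.hyps[OF psubset_card_mono[OF finite_ground F(1)] matroid_restriction[OF F(2)]
            loopless_restriction[OF less.prems(2) F(2)]] by blast+
    qed
    have S: "S \<in> rat_fps"
      unfolding S_def using IH(1) by (intro rat_fps_sum rat_fps.mult rat_fps.const) auto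
    have "\<mu> S = (\<Sum>F\<in>Pow E - {E}. \<mu> (fps_const (poly_at_q (l F)) * ?g F))"
      unfolding S_def using IH(1) by (intro mu_sum rat_fps.mult rat_fps.const) auto
    \<comment> \<open>Powers of \<open>q\<close> go to 1, and the cofactor \<open>l F\<close> goes
      to its value at 1, which is the derivative.\<close>
    also have "\<dots> = (\<Sum>F\<in>Pow E - {E}. of_int (poly (pderiv (contraction_poly E \<B> F)) 1) *
        \<mu> (positive_zeta F (restriction \<B> F)))"
    proof (rule sum.cong[OF refl])
      fix F assume "F \<in> Pow E - {E}"
      then show "\<mu> (fps_const (poly_at_q (l F)) * ?g F) =
          of_int (poly (pderiv (contraction_poly E \<B> F)) 1) * \<mu> (positive_zeta F (restriction \<B> F))"
        using IH(1) l1[of F]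
        by (simp add: mu_mult rat_fps.mult rat_fps.const mu_q_pow poly_at_q_def mu_const_poly psubset_eq)
    qed
    finally have muS: "\<mu> S = \<dots>" .
    let ?d = "\<lambda>F. poly (pderiv (contraction_poly E \<B> F)) 1"
    have "jet (\<mu> S) (\<Sum>F\<in>Pow E - {E}. of_int (?d F) * 1)
        (\<Sum>F\<in>Pow E - {E}. of_int (?d F) * (- of_nat (card F)) + 0 * 1)"
      unfolding muS by (intro jet_sum jet_mult jet_of_int IH(2))
    \<comment> \<open>The omitted term \<open>F = E\<close> has the derivative of the constant 1, so
      the sums over all subsets apply.\<close>
    moreover have "(\<Sum>F\<in>Pow E - {E}. of_int (?d F) * 1) = (of_nat ?r :: rat)"
    proof -
      have "(\<Sum>F\<in>Pow E - {E}. ?d F) = (\<Sum>F\<in>Pow E. ?d F)"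
        using finite_ground by (intro sum.mono_neutral_left) (auto simp: contraction_poly_ground)
      then show ?thesis
        using sum_pderiv_contraction_poly_1 by (simp flip: of_int_sum)
    qed
    moreover have "(\<Sum>F\<in>Pow E - {E}. of_int (?d F) * (- of_nat (card F)) + 0 * 1) =
        (- of_nat (card E) * (of_nat ?r - 1) :: rat)"
    proof -
      have "(\<Sum>F\<in>Pow E - {E}. int (card F) * ?d F) = (\<Sum>F\<in>Pow E. int (card F) * ?d F)"
        using finite_ground by (intro sum.mono_neutral_left) (auto simp: contraction_poly_ground)
      also have "\<dots> = int (card E) * (int ?r - 1)"
        using sum_card_pderiv_contraction_poly[OF less.prems(2)] r by (simp add: of_nat_diff)
      finally have "(\<Sum>F\<in>Pow E - {E}. of_int (int (card F) * ?d F)) =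
          (of_int (int (card E) * (int ?r - 1)) :: rat)"
        by (simp only: flip: of_int_sum)
      then show ?thesis
        by (simp add: sum_negf mult.commute)
    qed
    ultimately have jetS: "jet (\<mu> S) (of_nat ?r) (- of_nat (card E) * (of_nat ?r - 1))"
      by simp
    have gen: "rat_gen (card E) (- int ?r) \<in> rat_fps"
      using n by (rule rat_fps.gen)
    have pz: "positive_zeta E \<B> \<in> rat_fps"
      unfolding decomp(1) using gen S by (rule rat_fps.mult)
    \<comment> \<open>Here \<open>b = - ?r\<close> is nonzero by looplessness, so
      \<open>1 / (|E| s + rk E)\<close> has no pole at 0.\<close>
    have "jet (\<mu> (rat_gen (card E) (- int ?r)))
        (- 1 / of_int (- int ?r)) (- of_nat (card E) / of_int (- int ?r) ^ 2)"
      unfolding mu_rat_gen[OF n] using r by (intro jet_linear_inverse) simp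
    \<comment> \<open>With \<open>n = |E|\<close> and \<open>r = rk E\<close>:
      \<open>(1/r - n s/r^2) (r - n (r - 1) s) = 1 - n s + O(s^2)\<close>.\<close>
    from jet_mult[OF this jetS]
    have "jet (\<mu> (positive_zeta E \<B>)) 1 (- of_nat (card E))"
      unfolding decomp(1) mu_mult[OF gen S] using r
      by (simp add: field_simps power2_eq_square)
    moreover have q1: "fps_const (q_pow 1 - 1) * S \<in> rat_fps"
      using S by (intro rat_fps.mult rat_fps.const)
    \<comment> \<open>As \<open>q - 1\<close> specializes to 0, \<open>Z\<close> and
      \<open>Y\<close> have the same image.\<close>
    moreover have "\<mu> (fps_const (q_pow 1 - 1) * S) = 0"
      using mu_mult[OF rat_fps.const S, of "q_pow 1 - 1"] mu_const_diff[of "q_pow 1" 1]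
      by (simp add: mu_q mu_1)
    ultimately show ?thesis
      using pz mu_add[OF pz q1] rat_fps.add[OF pz q1] by (simp add: decomp(2))
  qed
qed

theorem theorem1p5:
  fixes E :: "'a set" and \<B> :: "'a set set"
  assumes "matroid E \<B>" and "loopless E \<B>"
  shows "ratfun_eval (zeta_top E \<B>) 0 = 1 \<and>
    ratfun_eval (ratfun_deriv (zeta_top E \<B>)) 0 = - of_nat (card E)"
  using mu_top.zeta_jet[OF assms] jet_eval[of "zeta_top E \<B>"] by (auto simp: zeta_top_def)

end
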